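(* Let $\mathbb{L}=TS^2$ be the space of oriented affine lines in $\mathbb{R}^3$ with its neutral Kähler metric $\mathbb{G}$. For $B_2,C_2\in\mathbb{R}$ with $B_2\geq0$ and $-2B_2\leq C_2$, consider the surface in $\mathbb{L}$ determined by $$F=\pm i\left[B_2+C_2R^2+B_2R^4\right]^{\frac12}e^{i\theta},\qquad \xi=Re^{i\theta}.$$ This can be extended through $R=0$ and $R\to\infty$, and yields a two-parameter family of area-stationary tori for $C_2\neq2B_2$. These tori are neither holomorphic nor lagrangian.
   Context: The space $\mathbb{L}$ of oriented affine lines in $\mathbb{R}^3$ is identified with $TS^2$. On $S^2$ take the holomorphic coordinate $\xi$ in which the round metric is $g=e^{2u}d\xi d\bar\xi$ with $e^{2u}=4(1+\xi\bar\xi)^{-2}$. Coordinates $(\xi,\eta)$ on $TS^2$ are given by identifying $(\xi,\eta)$ with $\eta\frac{\partial}{\partial\xi}+\bar\eta\frac{\partial}{\partial\bar\xi}\in T_\xi S^2$; they are holomorphic for the complex structure $\mathbb{J}=j\oplus j$ on $TTS^2\cong TS^2\oplus TS^2$, where $j$ is the complex structure of $S^2$ and the splitting is that of the Levi-Civita connection. The symplectic form is $\Omega=2\,\mathrm{Re}\left(e^{2u}d\eta\wedge d\bar\xi+\eta\,\partial(e^{2u})\,d\xi\wedge d\bar\xi\right)$ and the neutral Kähler metric is $\mathbb{G}=2\,\mathrm{Im}\left(e^{2u}d\bar\eta\, d\xi-\eta\,\partial(e^{2u})\,d\xi d\bar\xi\right)$, with $\partial=\partial/\partial\xi$. A surface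 is holomorphic if $\mathbb{J}$ preserves its tangent space, and lagrangian if $\Omega$ pulled back to it vanishes. The function $F$ determines the surface as the graph $\xi\mapsto(\xi,\eta=F(\xi,\bar\xi))$, with both signs taken. For the graph of a local section put $\sigma=-\partial\bar F$, $\rho=e^{-2u}\partial(Fe^{2u})$, $\lambda=\mathrm{Im}\,\rho$. The metric induced on the graph by $\mathbb{G}$ has determinant $(\lambda^2-\sigma\bar\sigma)e^{4u}$ in the coordinates $(\xi,\bar\xi)$, and the area functional on the graph is $A(F)=\int|\lambda^2-\sigma\bar\sigma|^{1/2}e^{2u}\,d\xi d\bar\xi$. A graph is area-stationary if the first variation satisfies $\delta A(F)=0$ for all variations $\delta F$ of $F$.
   Formalization: "Tori" (immersed if C₂=-2B₂, embedded otherwise) and "not holomorphic" need B₂>0: B₂=0 gives holomorphic spheres. "Area-stationary" is for variations compactly supported where the induced metric is nondegenerate (R≠0,1,∞); for variations across R=1 it fails. *)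

theory Defs
  imports "HOL-Analysis.Analysis"
begin

section \<open>Differentiability classes\<close>

text \<open>\<open>Ck_on n S f\<close>: \<open>f\<close> is of class \<open>C\<^sup>n\<close> on the (open) set \<open>S\<close>.\<close>

primrec Ck_on ::
  "nat \<Rightarrow> 'a::real_normed_vector set \<Rightarrow> ('a \<Rightarrow> 'b::real_normed_vector) \<Rightarrow> bool"
where
  "Ck_on 0 S f \<longleftrightarrow> continuous_on S f"
| "Ck_on (Suc n) S f \<longleftrightarrow> (\<forall>x\<in>S. f differentiable (at x)) \<and>
     (\<forall>v. Ck_on n S (\<lambda>x. frechet_derivative f (at x) v))"

definition smooth_on ::
  "'a::real_normed_vector set \<Rightarrow> ('a \<Rightarrow> 'b::real_normed_vector) \<Rightarrow> bool"
where "smooth_on S f \<longleftrightarrow> (\<forall>n. Ck_on n S f)"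

text \<open>The Wirtinger derivatives \<open>\<partial>f/\<partial>\<xi>\<close> and \<open>\<partial>f/\<partial>\<xi>\<close>-bar.\<close>

definition wirt :: "(complex \<Rightarrow> complex) \<Rightarrow> complex \<Rightarrow> complex"
where "wirt f \<xi> =
  (frechet_derivative f (at \<xi>) 1 - \<i> * frechet_derivative f (at \<xi>) \<i>) / 2"

definition wirt_bar :: "(complex \<Rightarrow> complex) \<Rightarrow> complex \<Rightarrow> complex"
where "wirt_bar f \<xi> =
  (frechet_derivative f (at \<xi>) 1 + \<i> * frechet_derivative f (at \<xi>) \<i>) / 2"


section \<open>The space of oriented lines\<close>

text \<open>A pair \<open>(p, v)\<close> in \<open>TS2\<close> is the oriented line through \<open>v\<close> with direction \<open>p\<close>.\<close>

definition TS2 :: "((real^3) \<times> (real^3)) set"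
where "TS2 = {(p, v). norm p = 1 \<and> inner p v = 0}"

text \<open>The inverse of stereographic projection from the south pole: \<open>\<xi> = 0\<close> is the north
  pole and \<open>\<xi> = tan (s/2) e\<^sup>i\<^sup>\<theta>\<close> is the point with polar angle \<open>s\<close> and longitude \<open>\<theta>\<close>.\<close>

definition stereo :: "complex \<Rightarrow> real^3"
where "stereo \<xi> = vector [2 * Re \<xi> / (1 + (norm \<xi>)\<^sup>2),
                           2 * Im \<xi> / (1 + (norm \<xi>)\<^sup>2),
                           (1 - (norm \<xi>)\<^sup>2) / (1 + (norm \<xi>)\<^sup>2)]"

text \<open>The real vector \<open>\<eta> \<partial>/\<partial>\<xi>\<close> + complex conjugate moves \<open>\<xi>\<close> with velocity \<open>\<eta>\<close>.\<close>

definition line_of :: "complex \<Rightarrow> complex \<Rightarrow> (real^3) \<times> (real^3)"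
where "line_of \<xi> \<eta> = (stereo \<xi>, frechet_derivative stereo (at \<xi>) \<eta>)"

text \<open>The factor \<open>e\<^sup>2\<^sup>u\<close>, and its \<open>\<xi>\<close>-derivative.\<close>

definition conf :: "complex \<Rightarrow> real"
where "conf \<xi> = 4 / (1 + (norm \<xi>)\<^sup>2)\<^sup>2"

definition dconf :: "complex \<Rightarrow> complex"
where "dconf \<xi> = wirt (\<lambda>z. complex_of_real (conf z)) \<xi>"


section \<open>The neutral Kaehler structure\<close>

text \<open>A tangent vector at the point with coordinates \<open>(\<xi>, \<eta>)\<close> is a pair \<open>(v, w)\<close> with
  \<open>v = d\<xi>\<close> and \<open>w = d\<eta>\<close>.  The only nonzero Christoffel symbols of the metric
  \<open>e\<^sup>2\<^sup>u d\<xi> d\<xi>\<close>-bar are \<open>\<partial>(e\<^sup>2\<^sup>u) / e\<^sup>2\<^sup>u\<close> and its conjugate, so the Levi-Civita splitting of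
  \<open>(v, w)\<close> has horizontal component \<open>v\<close> and vertical component
  \<open>w + (\<partial>(e\<^sup>2\<^sup>u) / e\<^sup>2\<^sup>u) \<eta> v\<close>.\<close>

definition christoffel :: "complex \<Rightarrow> complex"
where "christoffel \<xi> = dconf \<xi> / of_real (conf \<xi>)"

definition split_LC ::
  "complex \<Rightarrow> complex \<Rightarrow> complex \<times> complex \<Rightarrow> complex \<times> complex"
where "split_LC \<xi> \<eta> X = (fst X, snd X + christoffel \<xi> * \<eta> * fst X)"

definition unsplit_LC ::
  "complex \<Rightarrow> complex \<Rightarrow> complex \<times> complex \<Rightarrow> complex \<times> complex"
where "unsplit_LC \<xi> \<eta> Y = (fst Y, snd Y - christoffel \<xi> * \<eta> * fst Y)"

definition JJ ::
  "complex \<Rightarrow> complex \<Rightarrow> complex \<times> complex \<Rightarrow> complex \<times> complex"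
where "JJ \<xi> \<eta> X =
  unsplit_LC \<xi> \<eta> (\<i> * fst (split_LC \<xi> \<eta> X), \<i> * snd (split_LC \<xi> \<eta> X))"

lemma JJ_coordinates: "JJ \<xi> \<eta> (v, w) = (\<i> * v, \<i> * w)"
  by (simp add: JJ_def split_LC_def unsplit_LC_def algebra_simps)

definition Omega ::
  "complex \<Rightarrow> complex \<Rightarrow> complex \<times> complex \<Rightarrow> complex \<times> complex \<Rightarrow> real"
where "Omega \<xi> \<eta> X Y =
  2 * Re (of_real (conf \<xi>) * (snd X * cnj (fst Y) - snd Y * cnj (fst X))
        + \<eta> * dconf \<xi> * (fst X * cnj (fst Y) - fst Y * cnj (fst X)))"

text \<open>Juxtaposition of one-forms denotes the symmetric product
  \<open>\<alpha> \<beta> = (\<alpha> \<otimes> \<beta> + \<beta> \<otimes> \<alpha>) / 2\<close>, as in \<open>e\<^sup>2\<^sup>u d\<xi> d\<xi>\<close>-bar for the round metric.\<close>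

definition GG ::
  "complex \<Rightarrow> complex \<Rightarrow> complex \<times> complex \<Rightarrow> complex \<times> complex \<Rightarrow> real"
where "GG \<xi> \<eta> X Y =
  2 * Im (of_real (conf \<xi>) * ((cnj (snd X) * fst Y + cnj (snd Y) * fst X) / 2)
        - \<eta> * dconf \<xi> * ((fst X * cnj (fst Y) + fst Y * cnj (fst X)) / 2))"


section \<open>Graphs of local sections\<close>

definition graph_tangent :: "(complex \<Rightarrow> complex) \<Rightarrow> complex \<Rightarrow> (complex \<times> complex) set"
where "graph_tangent F \<xi> = range (\<lambda>v. (v, frechet_derivative F (at \<xi>) v))"

text \<open>The two conditions below are imposed at those points of the graph of \<open>F\<close> over \<open>U\<close> at
  which there is a tangent plane.\<close>

definition holomorphic_graph :: "complex set \<Rightarrow> (complex \<Rightarrow> complex) \<Rightarrow> bool"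
where "holomorphic_graph U F \<longleftrightarrow> (\<forall>\<xi>\<in>U. F differentiable (at \<xi>) \<longrightarrow>
  JJ \<xi> (F \<xi>) ` graph_tangent F \<xi> \<subseteq> graph_tangent F \<xi>)"

definition lagrangian_graph :: "complex set \<Rightarrow> (complex \<Rightarrow> complex) \<Rightarrow> bool"
where "lagrangian_graph U F \<longleftrightarrow> (\<forall>\<xi>\<in>U. F differentiable (at \<xi>) \<longrightarrow>
  (\<forall>X\<in>graph_tangent F \<xi>. \<forall>Y\<in>graph_tangent F \<xi>. Omega \<xi> (F \<xi>) X Y = 0))"

text \<open>The metric induced on the graph, its determinant in the real coordinates
  \<open>x + \<i> y = \<xi>\<close>, and the area of the part over \<open>K\<close>.\<close>

definition induced_metric ::
  "(complex \<Rightarrow> complex) \<Rightarrow> complex \<Rightarrow> complex \<Rightarrow> complex \<Rightarrow> real"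
where "induced_metric F \<xi> v w =
  GG \<xi> (F \<xi>) (v, frechet_derivative F (at \<xi>) v) (w, frechet_derivative F (at \<xi>) w)"

definition induced_det :: "(complex \<Rightarrow> complex) \<Rightarrow> complex \<Rightarrow> real"
where "induced_det F \<xi> =
  induced_metric F \<xi> 1 1 * induced_metric F \<xi> \<i> \<i> - (induced_metric F \<xi> 1 \<i>)\<^sup>2"

definition graph_area :: "complex set \<Rightarrow> (complex \<Rightarrow> complex) \<Rightarrow> real"
where "graph_area K F = (LINT \<xi>:K|lborel. sqrt \<bar>induced_det F \<xi>\<bar>)"

definition nondegenerate_locus ::
  "complex set \<Rightarrow> (complex \<Rightarrow> complex) \<Rightarrow> complex set"
where "nondegenerate_locus U F =
  {\<xi>\<in>U. F differentiable (at \<xi>) \<and> induced_det F \<xi> \<noteq> 0}"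

text \<open>The integrand of the area is not differentiable where the induced metric degenerates.
  Variations are therefore taken with compact support in the nondegenerate locus.\<close>

definition area_stationary :: "complex set \<Rightarrow> (complex \<Rightarrow> complex) \<Rightarrow> bool"
where "area_stationary U F \<longleftrightarrow>
  (\<forall>K \<phi>. compact K \<and> K \<subseteq> nondegenerate_locus U F \<and> Ck_on 1 UNIV \<phi> \<and> (\<forall>\<xi>. \<xi> \<notin> K \<longrightarrow> \<phi> \<xi> = 0) \<longrightarrow>
     ((\<lambda>t. graph_area K (\<lambda>\<xi>. F \<xi> + t *\<^sub>R \<phi> \<xi>)) has_real_derivative 0) (at 0))"

text \<open>The classical expressions for the induced metric.\<close>

definition sigma :: "(complex \<Rightarrow> complex) \<Rightarrow> complex \<Rightarrow> complex"
where "sigma F \<xi> = - wirt (\<lambda>z. cnj (F z)) \<xi>"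

definition rho :: "(complex \<Rightarrow> complex) \<Rightarrow> complex \<Rightarrow> complex"
where "rho F \<xi> = wirt (\<lambda>z. F z * of_real (conf z)) \<xi> / of_real (conf \<xi>)"

definition lambda :: "(complex \<Rightarrow> complex) \<Rightarrow> complex \<Rightarrow> real"
where "lambda F \<xi> = Im (rho F \<xi>)"

lemma conf_pos: "conf \<xi> > 0"
proof -
  have "1 + (norm \<xi>)\<^sup>2 > 0"
    by (simp add: add_pos_nonneg)
  then show ?thesis
    by (simp add: conf_def)
qed

lemma conf_differentiable: "conf differentiable (at \<xi>)"
proof -
  have "1 + inner x x \<noteq> 0" for x :: complex
    by (metis add_pos_nonneg inner_ge_zero less_irrefl zero_less_one)
  then show ?thesis
    unfolding conf_def[abs_def] power2_norm_eq_inner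
    by (intro derivative_intros differentiable_divide) auto
qed

lemma sigma_alt:
  assumes "F differentiable (at \<xi>)"
  shows "sigma F \<xi> = - cnj (wirt_bar F \<xi>)"
proof -
  have "(F has_derivative frechet_derivative F (at \<xi>)) (at \<xi>)"
    using assms by (simp add: frechet_derivative_works)
  then have "((\<lambda>z. cnj (F z)) has_derivative (\<lambda>v. cnj (frechet_derivative F (at \<xi>) v))) (at \<xi>)"
    by (rule has_derivative_cnj)
  then have "frechet_derivative (\<lambda>z. cnj (F z)) (at \<xi>) =
      (\<lambda>v. cnj (frechet_derivative F (at \<xi>) v))"
    by (rule frechet_derivative_at[symmetric])
  then show ?thesis
    by (simp add: sigma_def wirt_def wirt_bar_def)
qed

lemma rho_alt:
  assumes "F differentiable (at \<xi>)"
  shows "rho F \<xi> = wirt F \<xi> + F \<xi> * christoffel \<xi>"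
proof -
  let ?c = "\<lambda>z. complex_of_real (conf z)"
  have F: "(F has_derivative frechet_derivative F (at \<xi>)) (at \<xi>)"
    using assms by (simp add: frechet_derivative_works)
  have c: "(?c has_derivative frechet_derivative ?c (at \<xi>)) (at \<xi>)"
  proof -
    have "(conf has_derivative frechet_derivative conf (at \<xi>)) (at \<xi>)"
      using conf_differentiable by (simp add: frechet_derivative_works)
    then have "?c differentiable (at \<xi>)"
      unfolding differentiable_def by (blast intro: has_derivative_of_real)
    then show ?thesis by (simp add: frechet_derivative_works)
  qed
  have "frechet_derivative (\<lambda>z. F z * ?c z) (at \<xi>) =
      (\<lambda>v. F \<xi> * frechet_derivative ?c (at \<xi>) v + frechet_derivative F (at \<xi>) v * ?c \<xi>)"
    using has_derivative_mult[OF F c] by (rule frechet_derivative_at[symmetric])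
  then show ?thesis
    using conf_pos[of \<xi>]
    by (simp add: rho_def wirt_def christoffel_def dconf_def field_simps)
qed

text \<open>The factor 4 is the square of the modulus of the Jacobian determinant of \<open>(\<xi>, \<xi>\<close>-bar\<open>)\<close>
  with respect to \<open>(x, y)\<close>.\<close>

lemma induced_det_eq:
  assumes "F differentiable (at \<xi>)"
  shows "induced_det F \<xi> = 4 * ((lambda F \<xi>)\<^sup>2 - (norm (sigma F \<xi>))\<^sup>2) * (conf \<xi>)\<^sup>2"
proof -
  define a where "a = frechet_derivative F (at \<xi>) 1"
  define b where "b = frechet_derivative F (at \<xi>) \<i>"
  define c where "c = conf \<xi>"
  define g where "g = F \<xi> * christoffel \<xi>"
  have d: "F \<xi> * dconf \<xi> = of_real c * g"
    using conf_pos[of \<xi>] by (simp add: g_def c_def christoffel_def)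
  have s: "sigma F \<xi> = - cnj ((a + \<i> * b) / 2)"
    by (simp add: sigma_alt[OF assms] wirt_bar_def a_def b_def)
  have l: "lambda F \<xi> = Im ((a - \<i> * b) / 2 + g)"
    by (simp add: lambda_def rho_alt[OF assms] wirt_def a_def b_def g_def)
  have m: "induced_metric F \<xi> 1 1 = - 2 * c * (Im a + Im g)"
    "induced_metric F \<xi> \<i> \<i> = 2 * c * (Re b - Im g)"
    "induced_metric F \<xi> 1 \<i> = c * (Re a - Im b)"
    unfolding induced_metric_def GG_def d a_def[symmetric] b_def[symmetric] c_def[symmetric]
    by (simp_all add: field_simps)
  show ?thesis
    unfolding induced_det_def m s l c_def[symmetric] cmod_power2
    by (simp add: power2_eq_square field_simps)
qed


section \<open>Tori and the family of surfaces\<close>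

text \<open>Doubly periodic immersions of the plane, that is, immersions of the torus.\<close>

definition torus_immersion :: "(real \<times> real \<Rightarrow> (real^3) \<times> (real^3)) \<Rightarrow> bool"
where "torus_immersion \<Phi> \<longleftrightarrow>
  smooth_on UNIV \<Phi> \<and>
  (\<forall>s t. \<Phi> (s + 2 * pi, t) = \<Phi> (s, t) \<and> \<Phi> (s, t + 2 * pi) = \<Phi> (s, t)) \<and>
  (\<forall>x. inj (frechet_derivative \<Phi> (at x)))"

definition same_torus_point :: "real \<times> real \<Rightarrow> real \<times> real \<Rightarrow> bool"
where "same_torus_point x y \<longleftrightarrow>
  (\<exists>m n :: int. y = (fst x + 2 * pi * of_int m, snd x + 2 * pi * of_int n))"

definition embedded_torus :: "((real^3) \<times> (real^3)) set \<Rightarrow> bool"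
where "embedded_torus T \<longleftrightarrow>
  T \<subseteq> TS2 \<and> (\<exists>\<Phi>. torus_immersion \<Phi> \<and> range \<Phi> = T \<and>
    (\<forall>x y. \<Phi> x = \<Phi> y \<longrightarrow> same_torus_point x y))"

text \<open>Self-intersections are allowed, but not multiple coverings.\<close>

definition immersed_torus :: "((real^3) \<times> (real^3)) set \<Rightarrow> bool"
where "immersed_torus T \<longleftrightarrow>
  T \<subseteq> TS2 \<and> (\<exists>\<Phi> N. torus_immersion \<Phi> \<and> range \<Phi> = T \<and> closed N \<and> interior N = {} \<and>
    (\<forall>x y. x \<notin> N \<and> \<Phi> x = \<Phi> y \<longrightarrow> same_torus_point x y))"

text \<open>For \<open>\<xi> = R e\<^sup>i\<^sup>\<theta>\<close> with \<open>R > 0\<close> one has \<open>R = norm \<xi>\<close> and \<open>e\<^sup>i\<^sup>\<theta> = sgn \<xi>\<close>.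
  The argument \<open>\<epsilon>\<close> is the sign \<open>\<plusminus>\<close>: \<open>1\<close> or \<open>-1\<close>.\<close>

definition Fsec :: "real \<Rightarrow> real \<Rightarrow> real \<Rightarrow> complex \<Rightarrow> complex"
where "Fsec \<epsilon> B C \<xi> =
  of_real \<epsilon> * \<i> * of_real (sqrt (B + C * (norm \<xi>)^2 + B * (norm \<xi>)^4)) * sgn \<xi>"

definition surface :: "real \<Rightarrow> real \<Rightarrow> ((real^3) \<times> (real^3)) set"
where "surface B C = (\<Union>\<epsilon>\<in>{1, -1}. (\<lambda>\<xi>. line_of \<xi> (Fsec \<epsilon> B C \<xi>)) ` (- {0}))"

text \<open>The graph of \<open>F\<close>, written in polar coordinates \<open>(R, \<theta>)\<close>, respectively
  \<open>(1/R, \<theta>)\<close>, continues smoothly across \<open>R = 0\<close>, respectively \<open>1/R = 0\<close>.\<close>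

definition extends_through_zero :: "(complex \<Rightarrow> complex) \<Rightarrow> bool"
where "extends_through_zero F \<longleftrightarrow>
  (\<exists>\<delta>>0. \<exists>\<Psi>. smooth_on ({-\<delta><..<\<delta>} \<times> UNIV) \<Psi> \<and> \<Psi> ` ({-\<delta><..<\<delta>} \<times> UNIV) \<subseteq> TS2 \<and>
     (\<forall>r \<theta>. 0 < r \<and> r < \<delta> \<longrightarrow> \<Psi> (r, \<theta>) = line_of (rcis r \<theta>) (F (rcis r \<theta>))))"

definition extends_through_infinity :: "(complex \<Rightarrow> complex) \<Rightarrow> bool"
where "extends_through_infinity F \<longleftrightarrow>
  (\<exists>\<delta>>0. \<exists>\<Psi>. smooth_on ({-\<delta><..<\<delta>} \<times> UNIV) \<Psi> \<and> \<Psi> ` ({-\<delta><..<\<delta>} \<times> UNIV) \<subseteq> TS2 \<and>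
     (\<forall>r \<theta>. 0 < r \<and> r < \<delta> \<longrightarrow> \<Psi> (r, \<theta>) = line_of (rcis (1 / r) \<theta>) (F (rcis (1 / r) \<theta>))))"

end

theory Submission
  imports Defs
begin

text \<open>Put \<open>q = |\<xi>|\<^sup>2\<close>.  The sections of the family are \<open>F = \<i> \<epsilon> g(q) \<xi>\<close> with \<open>g(q)\<^sup>2 = B/q + C + B q\<close>,
and everything rests on this rotational form.

The family of tori.  Since multiplication by \<open>\<i>\<close> is the quarter turn, \<open>F\<close> is tangent to the
circles of latitude.  In terms of the polar angle \<open>s\<close> and the longitude \<open>t\<close>, the line of
direction \<open>p(s,t)\<close> is displaced by \<open>c\<close> times the unit vector in the direction of longitude,
where \<open>c\<^sup>2 = 4 B cos\<^sup>2 s + (C + 2 B) sin\<^sup>2 s\<close> (lemma \<open>surface_eq\<close>).  If \<open>s\<close> runs through the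
whole circle instead of the interval from \<open>0\<close> to \<open>\<pi>\<close>, the substitution \<open>(s, t) \<mapsto> (-s, t + \<pi>)\<close>
fixes the direction and reverses the longitudinal unit vector, so a single function \<open>c = h(s)\<close>
of \<open>cos s\<close> parametrises the graphs for both signs, joined at the poles: this gives a doubly
periodic parametrisation of the closure (\<open>range_torus_map\<close>).  For \<open>C > -2B\<close> the square root is
smooth and positive, and the torus is embedded.  For \<open>C = -2B\<close> the smooth choice is
\<open>h = 2 \<surd>B cos s\<close>, which vanishes on the equator, where the torus passes through itself.  The
squared displacement is a quadratic function of the height of \<open>p\<close>, and its values on the equator
and elsewhere determine \<open>B\<close> and \<open>C\<close>.

Stationarity.  For this \<open>g\<close> one finds \<open>\<lambda>\<^sup>2 - |\<sigma>|\<^sup>2 = (C - 2B) ((1 - q) / (1 + q))\<^sup>2\<close>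
(\<open>lambda_sigma_difference\<close>).  Hence, off the unit circle, the linearised area density of a
variation \<open>\<phi>\<close> is a constant times \<open>\<lambda> \<lambda>(\<phi>) - Re (\<sigma> \<sigma>(\<phi>)\<close>-bar\<open>)\<close> divided by \<open>(1 + q) |1 - q|\<close>, and
up to sign this is half the divergence of an explicit vector field, linear in \<open>\<phi>\<close>: the
Euler-Lagrange equation reduces to the ordinary differential equation \<open>weight_equation\<close>.  The
divergence of a compactly supported field integrates to zero because the integral is translation
invariant (\<open>integral_directional_derivative_zero\<close>).  The derivative may be taken under the
integral because the density is the root of the modulus of a quadratic polynomial in the
parameter, whose constant term is bounded away from zero on the support
(\<open>has_derivative_sqrt_quadratic_integral\<close>).

The remaining assertions are read off from the same formulas: \<open>\<partial>\<close>-bar\<open> F\<close> is proportional to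
\<open>g'\<close>, which does not vanish off the unit circle if \<open>B > 0\<close>; the form \<open>\<Omega>\<close> restricts to a multiple
of \<open>\<lambda>\<close>, which cannot vanish on both of the circles of radius \<open>2\<close> and \<open>3\<close>.\<close>

section \<open>Closure properties of differentiability classes\<close>

lemma Ck_on_cong:
  assumes S: "open S"
  shows "(\<And>x. x \<in> S \<Longrightarrow> g x = h x) \<Longrightarrow> Ck_on n S h \<Longrightarrow> Ck_on n S g"
proof (induction n arbitrary: g h)
  case 0
  then show ?case by (simp cong: continuous_on_cong)
next
  case (Suc n)
  have D: "(g has_derivative frechet_derivative h (at x)) (at x)" if "x \<in> S" for x
  proof -
    have "(h has_derivative frechet_derivative h (at x)) (at x)"
      using Suc.prems(2) that by (simp add: frechet_derivative_works)
    then show ?thesis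
      using S that by (rule has_derivative_transform_within_open) (simp add: Suc.prems(1))
  qed
  then have "frechet_derivative g (at x) v = frechet_derivative h (at x) v" if "x \<in> S" for x v
    using frechet_derivative_at[OF D[OF that]] by simp
  moreover have "Ck_on n S (\<lambda>x. frechet_derivative h (at x) v)" for v
    using Suc.prems(2) by simp
  ultimately have "Ck_on n S (\<lambda>x. frechet_derivative g (at x) v)" for v
    by (rule Suc.IH)
  with D show ?case
    by (auto simp: differentiable_def)
qed

lemma Ck_on_Suc:
  assumes S: "open S" and D: "\<And>x. x \<in> S \<Longrightarrow> (f has_derivative D x) (at x)"
    and C: "\<And>v. Ck_on n S (\<lambda>x. D x v)"
  shows "Ck_on (Suc n) S f"
proof -
  have "frechet_derivative f (at x) v = D x v" if "x \<in> S" for x v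
    using frechet_derivative_at[OF D[OF that]] by simp
  then have "Ck_on n S (\<lambda>x. frechet_derivative f (at x) v)" for v
    by (rule Ck_on_cong[OF S _ C])
  then show ?thesis
    using D by (auto simp: differentiable_def)
qed

lemma Ck_on_SucD:
  assumes S: "open S"
  shows "Ck_on (Suc n) S f \<Longrightarrow> Ck_on n S f"
proof (induction n arbitrary: f)
  case 0
  then have "f differentiable_on S"
    using differentiable_at_withinI unfolding differentiable_on_def by auto
  then show ?case by (simp add: differentiable_imp_continuous_on)
next
  case (Suc n)
  from Suc.prems have "\<forall>v. Ck_on (Suc n) S (\<lambda>x. frechet_derivative f (at x) v)"
    "\<forall>x\<in>S. f differentiable (at x)" by simp_all
  with Suc.IH show ?case by auto
qed

lemma Ck_on_has_derivative:
  "Ck_on (Suc n) S f \<Longrightarrow> x \<in> S \<Longrightarrow> (f has_derivative frechet_derivative f (at x)) (at x)"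
  by (simp add: frechet_derivative_works)

lemma Ck_on_const: "Ck_on n S (\<lambda>x. c)"
  by (induction n arbitrary: c) auto

lemma Ck_on_bounded_linear:
  assumes L: "bounded_linear L" and S: "open S"
  shows "Ck_on n S f \<Longrightarrow> Ck_on n S (\<lambda>x. L (f x))"
proof (induction n arbitrary: f)
  case 0
  then show ?case by (simp add: bounded_linear.continuous_on[OF L])
next
  case (Suc n)
  show ?case
    using Suc
    by (intro Ck_on_Suc[OF S bounded_linear.has_derivative[OF L Ck_on_has_derivative[OF Suc.prems]]])
       auto
qed

lemma Ck_on_ident: "Ck_on n S (\<lambda>x. x)"
  by (cases n) (auto intro!: Ck_on_const)

lemma Ck_on_add:
  assumes S: "open S"
  shows "Ck_on n S f \<Longrightarrow> Ck_on n S g \<Longrightarrow> Ck_on n S (\<lambda>x. f x + g x)"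
proof (induction n arbitrary: f g)
  case 0
  then show ?case by (simp add: continuous_on_add)
next
  case (Suc n)
  show ?case
    using Suc
    by (intro Ck_on_Suc[OF S has_derivative_add[OF Ck_on_has_derivative[OF Suc.prems(1)]
              Ck_on_has_derivative[OF Suc.prems(2)]]]) auto
qed

lemma Ck_on_mult:
  fixes f g :: "'a::real_normed_vector \<Rightarrow> real"
  assumes S: "open S"
  shows "Ck_on n S f \<Longrightarrow> Ck_on n S g \<Longrightarrow> Ck_on n S (\<lambda>x. f x * g x)"
proof (induction n arbitrary: f g)
  case 0
  then show ?case by (simp add: continuous_on_mult)
next
  case (Suc n)
  have "Ck_on n S f" "Ck_on n S g"
    using Suc.prems Ck_on_SucD[OF S] by blast+
  then show ?case
    using Suc
    by (intro Ck_on_Suc[OF S has_derivative_mult[OF Ck_on_has_derivative[OF Suc.prems(1)]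
              Ck_on_has_derivative[OF Suc.prems(2)]]])
       (auto intro!: Ck_on_add[OF S])
qed

lemma Ck_on_sin_cos:
  fixes u :: "'a::real_normed_vector \<Rightarrow> real"
  assumes S: "open S"
  shows "Ck_on n S u \<Longrightarrow> Ck_on n S (\<lambda>x. sin (u x)) \<and> Ck_on n S (\<lambda>x. cos (u x))"
proof (induction n)
  case 0
  then show ?case by (simp add: continuous_on_sin continuous_on_cos)
next
  case (Suc n)
  have u: "Ck_on n S u" using Suc.prems Ck_on_SucD[OF S] by blast
  have du: "Ck_on n S (\<lambda>x. frechet_derivative u (at x) v)" for v
    using Suc.prems by simp
  note D = Ck_on_has_derivative[OF Suc.prems]
  have "Ck_on (Suc n) S (\<lambda>x. sin (u x))"
    using D by (intro Ck_on_Suc[OF S, where D = "\<lambda>x v. cos (u x) * frechet_derivative u (at x) v"])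
       (auto intro!: derivative_eq_intros Ck_on_mult[OF S] du Suc.IH[OF u, THEN conjunct2])
  moreover have "Ck_on (Suc n) S (\<lambda>x. cos (u x))"
  proof (rule Ck_on_Suc[OF S])
    show "((\<lambda>x. cos (u x)) has_derivative
        (\<lambda>v. (-1) * (sin (u x) * frechet_derivative u (at x) v))) (at x)" if "x \<in> S" for x
      using D[OF that] by (auto intro!: derivative_eq_intros)
    show "Ck_on n S (\<lambda>x. (-1) * (sin (u x) * frechet_derivative u (at x) v))" for v
      by (intro Ck_on_mult[OF S] Ck_on_const du Suc.IH[OF u, THEN conjunct1])
  qed
  ultimately show ?case by blast
qed

text \<open>The function \<open>w = 1 / \<surd>u\<close> satisfies \<open>dw = - w\<^sup>3 du / 2\<close>, an expression in \<open>w\<close> itself, so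
the induction on the order closes without a formula for higher derivatives.  Roots and
reciprocals are then the products \<open>u w\<close> and \<open>w\<^sup>2\<close>.\<close>

lemma Ck_on_inverse_sqrt:
  fixes u :: "'a::real_normed_vector \<Rightarrow> real"
  assumes S: "open S" and pos: "\<And>x. x \<in> S \<Longrightarrow> u x > 0"
  shows "Ck_on n S u \<Longrightarrow> Ck_on n S (\<lambda>x. 1 / sqrt (u x))"
proof (induction n)
  case 0
  then show ?case
    using pos
    by (force intro: continuous_on_divide continuous_on_const continuous_on_real_sqrt)
next
  case (Suc n)
  let ?w = "\<lambda>x. 1 / sqrt (u x)"
  have w: "Ck_on n S ?w" using Suc Ck_on_SucD[OF S] by blast
  have du: "Ck_on n S (\<lambda>x. frechet_derivative u (at x) v)" for v
    using Suc.prems by simp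
  have D: "(?w has_derivative (\<lambda>v. (-1/2) * (?w x * ?w x * ?w x) * frechet_derivative u (at x) v)) (at x)"
    if "x \<in> S" for x
  proof -
    have "(u has_derivative frechet_derivative u (at x)) (at x)"
      using Ck_on_has_derivative[OF Suc.prems that] .
    then show ?thesis
      using pos[OF that]
      by (auto intro!: derivative_eq_intros simp: field_simps)
  qed
  show ?case
    by (rule Ck_on_Suc[OF S D]) (assumption, intro Ck_on_mult[OF S] Ck_on_const w du)
qed

lemma Ck_on_sqrt:
  fixes u :: "'a::real_normed_vector \<Rightarrow> real"
  assumes S: "open S" and pos: "\<And>x. x \<in> S \<Longrightarrow> u x > 0" and u: "Ck_on n S u"
  shows "Ck_on n S (\<lambda>x. sqrt (u x))"
  by (rule Ck_on_cong[OF S _ Ck_on_mult[OF S u Ck_on_inverse_sqrt[OF S pos u]]])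
     (use pos in \<open>auto simp: real_div_sqrt less_imp_le\<close>)

lemma Ck_on_inverse:
  fixes u :: "'a::real_normed_vector \<Rightarrow> real"
  assumes S: "open S" and pos: "\<And>x. x \<in> S \<Longrightarrow> u x > 0" and u: "Ck_on n S u"
  shows "Ck_on n S (\<lambda>x. 1 / u x)"
proof -
  note w = Ck_on_inverse_sqrt[OF S pos u]
  show ?thesis
    by (rule Ck_on_cong[OF S _ Ck_on_mult[OF S w w]]) (use pos in \<open>auto simp: less_imp_le\<close>)
qed

section \<open>Maps into pairs of vectors in three-space\<close>

abbreviation vec3 :: "real \<Rightarrow> real \<Rightarrow> real \<Rightarrow> real^3"
  where "vec3 a b c \<equiv> vector [a, b, c]"

lemma vec3_pair_expand:
  "(vec3 a b c, vec3 d e f) =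
     a *\<^sub>R (vec3 1 0 0, 0) + b *\<^sub>R (vec3 0 1 0, 0) + c *\<^sub>R (vec3 0 0 1, 0) +
     (d *\<^sub>R (0, vec3 1 0 0) + e *\<^sub>R (0, vec3 0 1 0) + f *\<^sub>R (0, vec3 0 0 1))"
  by (simp add: vec_eq_iff forall_3)

lemma Ck_on_vec3_pair:
  assumes S: "open S" and "Ck_on n S a" "Ck_on n S b" "Ck_on n S c"
    "Ck_on n S d" "Ck_on n S e" "Ck_on n S f"
  shows "Ck_on n S (\<lambda>x. (vec3 (a x) (b x) (c x), vec3 (d x) (e x) (f x)))"
  unfolding vec3_pair_expand
  by (intro Ck_on_add[OF S] assms Ck_on_bounded_linear[OF bounded_linear_scaleR_left S])

lemma has_derivative_vec3_pair:
  assumes "(a has_derivative a') F" "(b has_derivative b') F" "(c has_derivative c') F"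
    "(d has_derivative d') F" "(e has_derivative e') F" "(f has_derivative f') F"
  shows "((\<lambda>x. (vec3 (a x) (b x) (c x), vec3 (d x) (e x) (f x))) has_derivative
     (\<lambda>v. (vec3 (a' v) (b' v) (c' v), vec3 (d' v) (e' v) (f' v)))) F"
  unfolding vec3_pair_expand
  by (intro has_derivative_add has_derivative_scaleR_left assms)

lemma vec3_eq_iff [simp]: "vec3 a b c = vec3 a' b' c' \<longleftrightarrow> a = a' \<and> b = b' \<and> c = c'"
  by (simp add: vec_eq_iff forall_3)

lemma inner_vec3: "inner (vec3 a b c) (vec3 a' b' c') = a * a' + b * b' + c * c'"
  by (simp add: inner_vec_def sum_3)

lemma norm_vec3: "norm (vec3 a b c) = sqrt (a^2 + b^2 + c^2)"
  by (simp add: norm_eq_sqrt_inner inner_vec3 power2_eq_square)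

section \<open>The surfaces in spherical coordinates\<close>

text \<open>The oriented line with direction of polar angle \<open>s\<close> and longitude \<open>t\<close>, displaced by \<open>c\<close> in
the direction of increasing longitude.\<close>

definition line_at :: "real \<Rightarrow> real \<Rightarrow> real \<Rightarrow> (real^3) \<times> (real^3)"
  where "line_at s t c =
    (vec3 (sin s * cos t) (sin s * sin t) (cos s), vec3 (- c * sin t) (c * cos t) 0)"

lemma line_at_in_TS2: "line_at s t c \<in> TS2"
proof -
  have "(sin s * cos t)\<^sup>2 + (sin s * sin t)\<^sup>2 + (cos s)\<^sup>2 =
      (sin s)\<^sup>2 * ((cos t)\<^sup>2 + (sin t)\<^sup>2) + (cos s)\<^sup>2"
    by (simp only: power_mult_distrib distrib_left)
  also have "\<dots> = 1" by simp
  finally have "(sin s * cos t)\<^sup>2 + (sin s * sin t)\<^sup>2 + (cos s)\<^sup>2 = 1" .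
  then show ?thesis
    by (simp add: TS2_def line_at_def norm_vec3 inner_vec3)
qed

text \<open>Passing through the pole reverses the longitudinal unit vector.  This is what joins the
graphs for the two signs into one surface.\<close>

lemma line_at_flip: "line_at (- s) (t + pi) (- c) = line_at s t c"
  by (simp add: line_at_def)

lemma one_plus_pos: "1 + (norm (x::complex))\<^sup>2 > 0" "1 + (r::real)\<^sup>2 > 0"
  by (simp_all add: add_pos_nonneg)

text \<open>The vector \<open>\<i> c \<xi>\<close> is orthogonal to \<open>\<xi>\<close>, so the derivative of \<open>|\<xi>|\<^sup>2\<close> along it vanishes
and only the numerators of the two horizontal components contribute.\<close>

lemma line_of_rotation:
  "line_of \<xi> (\<i> * of_real c * \<xi>) =
     (stereo \<xi>, vec3 (- 2 * c * Im \<xi> / (1 + (norm \<xi>)\<^sup>2)) (2 * c * Re \<xi> / (1 + (norm \<xi>)\<^sup>2)) 0)"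
proof -
  let ?q = "\<lambda>z. 1 + ((Re z)\<^sup>2 + (Im z)\<^sup>2)"
  let ?Q = "?q \<xi>"
  let ?dq = "\<lambda>v. 2 * (Re \<xi> * Re v + Im \<xi> * Im v)"
  have pos: "?Q \<noteq> 0"
    using one_plus_pos(1)[of \<xi>] by (simp add: cmod_power2)
  have dRe: "(Re has_derivative Re) (at \<xi>)" and dIm: "(Im has_derivative Im) (at \<xi>)"
    by (auto intro!: bounded_linear_imp_has_derivative bounded_linear_Re bounded_linear_Im)
  have dq: "(?q has_derivative ?dq) (at \<xi>)"
    by (auto intro!: derivative_eq_intros dRe dIm simp: algebra_simps)
  note quot = has_derivative_divide'[OF _ dq pos]
  have d1: "((\<lambda>z. 2 * Re z / ?q z) has_derivative
      (\<lambda>v. (2 * Re v * ?Q - 2 * Re \<xi> * ?dq v) / (?Q * ?Q))) (at \<xi>)"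
    by (rule quot) (auto intro!: derivative_eq_intros dRe)
  have d2: "((\<lambda>z. 2 * Im z / ?q z) has_derivative
      (\<lambda>v. (2 * Im v * ?Q - 2 * Im \<xi> * ?dq v) / (?Q * ?Q))) (at \<xi>)"
    by (rule quot) (auto intro!: derivative_eq_intros dIm)
  have d3: "((\<lambda>z. (1 - ((Re z)\<^sup>2 + (Im z)\<^sup>2)) / ?q z) has_derivative
      (\<lambda>v. (- ?dq v * ?Q - (1 - ((Re \<xi>)\<^sup>2 + (Im \<xi>)\<^sup>2)) * ?dq v) / (?Q * ?Q))) (at \<xi>)"
    by (rule quot) (auto intro!: derivative_eq_intros dRe dIm simp: algebra_simps)
  have st: "stereo = (\<lambda>z. vec3 (2 * Re z / ?q z) (2 * Im z / ?q z)
      ((1 - ((Re z)\<^sup>2 + (Im z)\<^sup>2)) / ?q z))"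
    by (rule ext) (simp add: stereo_def cmod_power2)
  have zero: "((\<lambda>z::complex. 0::real) has_derivative (\<lambda>v. 0)) (at \<xi>)" by simp
  have "(stereo has_derivative (\<lambda>v. vec3 ((2 * Re v * ?Q - 2 * Re \<xi> * ?dq v) / (?Q * ?Q))
      ((2 * Im v * ?Q - 2 * Im \<xi> * ?dq v) / (?Q * ?Q))
      ((- ?dq v * ?Q - (1 - ((Re \<xi>)\<^sup>2 + (Im \<xi>)\<^sup>2)) * ?dq v) / (?Q * ?Q)))) (at \<xi>)"
    unfolding st using has_derivative_fst[OF has_derivative_vec3_pair[OF d1 d2 d3 zero zero zero]]
    by simp
  then have "frechet_derivative stereo (at \<xi>) = (\<lambda>v. vec3 ((2 * Re v * ?Q - 2 * Re \<xi> * ?dq v) / (?Q * ?Q))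
      ((2 * Im v * ?Q - 2 * Im \<xi> * ?dq v) / (?Q * ?Q))
      ((- ?dq v * ?Q - (1 - ((Re \<xi>)\<^sup>2 + (Im \<xi>)\<^sup>2)) * ?dq v) / (?Q * ?Q)))"
    by (rule frechet_derivative_at[symmetric])
  moreover have "?dq (\<i> * of_real c * \<xi>) = 0" by (simp add: algebra_simps)
  ultimately show ?thesis
    using pos by (simp add: line_of_def cmod_power2)
qed

lemma line_of_Fsec_polar:
  fixes \<epsilon> B C r t :: real
  assumes r: "r > 0"
  defines "k \<equiv> \<epsilon> * (2 * sqrt (B + C * r\<^sup>2 + B * r^4) / (1 + r\<^sup>2))"
  shows "line_of (rcis r t) (Fsec \<epsilon> B C (rcis r t)) =
    (vec3 (2 * r / (1 + r\<^sup>2) * cos t) (2 * r / (1 + r\<^sup>2) * sin t) ((1 - r\<^sup>2) / (1 + r\<^sup>2)),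
     vec3 (- k * sin t) (k * cos t) 0)"
proof -
  define f where "f = sqrt (B + C * r\<^sup>2 + B * r^4)"
  have n: "norm (rcis r t) = r" using r by (simp add: norm_mult rcis_def)
  have "sgn (rcis r t) = cis t"
    using r by (simp add: sgn_eq rcis_def norm_mult)
  then have "Fsec \<epsilon> B C (rcis r t) = \<i> * of_real (\<epsilon> * f / r) * rcis r t"
    using r unfolding Fsec_def n f_def[symmetric] by (simp add: rcis_def)
  moreover have "stereo (rcis r t) =
      vec3 (2 * r / (1 + r\<^sup>2) * cos t) (2 * r / (1 + r\<^sup>2) * sin t) ((1 - r\<^sup>2) / (1 + r\<^sup>2))"
    by (simp add: stereo_def n)
  ultimately show ?thesis
    unfolding k_def f_def[symmetric] using r by (simp only: line_of_rotation n) simp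
qed

lemma spherical_from_radius:
  fixes r :: real
  assumes "r > 0"
  obtains s where "sin s = 2 * r / (1 + r\<^sup>2)" "cos s = (1 - r\<^sup>2) / (1 + r\<^sup>2)" "sin s > 0"
proof -
  have "((1 - r\<^sup>2) / (1 + r\<^sup>2))\<^sup>2 + (2 * r / (1 + r\<^sup>2))\<^sup>2 = 1"
    using one_plus_pos(2)[of r] by (simp add: field_simps) algebra
  then obtain s where "(1 - r\<^sup>2) / (1 + r\<^sup>2) = cos s" "2 * r / (1 + r\<^sup>2) = sin s"
    using sincos_total_2pi by metis
  moreover have "2 * r / (1 + r\<^sup>2) > 0"
    using assms one_plus_pos(2)[of r] by simp
  ultimately show ?thesis by (intro that[of s]) auto
qed

lemma radius_from_spherical:
  fixes s :: real
  assumes "sin s > 0"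
  obtains r where "r > 0" "sin s = 2 * r / (1 + r\<^sup>2)" "cos s = (1 - r\<^sup>2) / (1 + r\<^sup>2)"
proof -
  have sc: "(sin s)\<^sup>2 + (cos s)\<^sup>2 = 1" by simp
  have "(cos s)\<^sup>2 < 1" using assms sc by (smt (verit) zero_less_power)
  then have c: "1 + cos s > 0" using abs_square_less_1[of "cos s"] by linarith
  define r where "r = sin s / (1 + cos s)"
  have "1 + r\<^sup>2 = ((1 + cos s)\<^sup>2 + (sin s)\<^sup>2) / (1 + cos s)\<^sup>2"
    using c by (simp add: r_def power_divide add_divide_distrib)
  also have "(1 + cos s)\<^sup>2 + (sin s)\<^sup>2 = 2 * (1 + cos s)"
    using sc by (simp add: power2_eq_square algebra_simps)
  also have "2 * (1 + cos s) / (1 + cos s)\<^sup>2 = 2 / (1 + cos s)"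
    using c by (simp add: divide_simps power2_eq_square)
  finally have a: "1 + r\<^sup>2 = 2 / (1 + cos s)" .
  then have b: "1 - r\<^sup>2 = 2 * cos s / (1 + cos s)"
    using c by (simp add: field_simps)
  show ?thesis
  proof
    show "r > 0" using assms c by (simp add: r_def)
    show "sin s = 2 * r / (1 + r\<^sup>2)" unfolding a using c by (simp add: r_def)
    show "cos s = (1 - r\<^sup>2) / (1 + r\<^sup>2)" unfolding a b using c by simp
  qed
qed

lemma radicand_sum_of_squares:
  "B + C * r\<^sup>2 + B * r^4 = B * (1 - r\<^sup>2)\<^sup>2 + (C + 2 * B) * (r::real)\<^sup>2"
  by (simp add: power2_eq_square power4_eq_xxxx algebra_simps)

text \<open>With \<open>r = tan (s/2)\<close> one has \<open>(1 - r\<^sup>2) / (1 + r\<^sup>2) = cos s\<close> and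
\<open>2 r / (1 + r\<^sup>2) = sin s\<close>, so writing the radicand as a sum of squares turns it into a quadratic
form in \<open>cos s\<close> and \<open>sin s\<close>.\<close>

lemma fibre_length_squared:
  fixes r :: real
  assumes "B \<ge> 0" "- 2 * B \<le> C"
    and "sin s = 2 * r / (1 + r\<^sup>2)" "cos s = (1 - r\<^sup>2) / (1 + r\<^sup>2)"
  shows "(2 * sqrt (B + C * r\<^sup>2 + B * r^4) / (1 + r\<^sup>2))\<^sup>2 =
    4 * B * (cos s)\<^sup>2 + (C + 2 * B) * (sin s)\<^sup>2"
proof -
  have "B * (1 - r\<^sup>2)\<^sup>2 + (C + 2 * B) * r\<^sup>2 \<ge> 0" using assms(1,2) by simp
  then show ?thesis
    using one_plus_pos(2)[of r]
    unfolding assms(3,4) radicand_sum_of_squares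
    by (simp add: power_divide power_mult_distrib add_divide_distrib algebra_simps)
qed

lemma surface_eq:
  assumes "B \<ge> 0" "- 2 * B \<le> C"
  shows "surface B C = {line_at s t c | s t c.
    sin s > 0 \<and> c\<^sup>2 = 4 * B * (cos s)\<^sup>2 + (C + 2 * B) * (sin s)\<^sup>2}" (is "_ = ?S")
proof
  show "surface B C \<subseteq> ?S"
  proof
    fix x assume "x \<in> surface B C"
    then obtain \<epsilon> \<xi> where e: "\<epsilon> \<in> {1, -1}" and xi: "\<xi> \<noteq> 0" and x: "x = line_of \<xi> (Fsec \<epsilon> B C \<xi>)"
      by (auto simp: surface_def)
    define r where "r = norm \<xi>"
    have r: "r > 0" using xi by (simp add: r_def)
    have xi': "\<xi> = rcis r (Arg \<xi>)" by (simp add: r_def rcis_cmod_Arg)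
    obtain s where s: "sin s = 2 * r / (1 + r\<^sup>2)" "cos s = (1 - r\<^sup>2) / (1 + r\<^sup>2)" "sin s > 0"
      using spherical_from_radius[OF r] .
    define c where "c = \<epsilon> * (2 * sqrt (B + C * r\<^sup>2 + B * r^4) / (1 + r\<^sup>2))"
    have "\<epsilon>\<^sup>2 = 1" using e by auto
    then have "c\<^sup>2 = (2 * sqrt (B + C * r\<^sup>2 + B * r^4) / (1 + r\<^sup>2))\<^sup>2"
      by (simp only: c_def power_mult_distrib mult_1)
    then have "c\<^sup>2 = 4 * B * (cos s)\<^sup>2 + (C + 2 * B) * (sin s)\<^sup>2"
      using fibre_length_squared[OF assms s(1,2)] by simp
    moreover have "x = line_at s (Arg \<xi>) c"
      unfolding x line_at_def s(1,2) c_def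
      by (subst (1 2) xi', subst line_of_Fsec_polar[OF r]) simp
    ultimately show "x \<in> ?S" using s(3) by blast
  qed
  show "?S \<subseteq> surface B C"
  proof
    fix x assume "x \<in> ?S"
    then obtain s t c where x: "x = line_at s t c" and s: "sin s > 0"
      and c: "c\<^sup>2 = 4 * B * (cos s)\<^sup>2 + (C + 2 * B) * (sin s)\<^sup>2" by blast
    obtain r where r: "r > 0" "sin s = 2 * r / (1 + r\<^sup>2)" "cos s = (1 - r\<^sup>2) / (1 + r\<^sup>2)"
      using radius_from_spherical[OF s] .
    define k where "k = 2 * sqrt (B + C * r\<^sup>2 + B * r^4) / (1 + r\<^sup>2)"
    have "c\<^sup>2 = k\<^sup>2" unfolding k_def using fibre_length_squared[OF assms r(2,3)] c by simp
    then have "c = 1 * k \<or> c = (-1) * k" by (simp add: power2_eq_iff)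
    then obtain \<epsilon> where e: "\<epsilon> \<in> {1, -1}" "c = \<epsilon> * k" by blast
    have "x = line_of (rcis r t) (Fsec \<epsilon> B C (rcis r t))"
      unfolding line_of_Fsec_polar[OF r(1)] x line_at_def r(2,3) e(2) k_def by simp
    moreover have "rcis r t \<noteq> 0" using r(1) by simp
    ultimately show "x \<in> surface B C"
      using e(1) unfolding surface_def by blast
  qed
qed

lemma closure_surface_length:
  assumes "B \<ge> 0" "- 2 * B \<le> C" and x: "(p, v) \<in> closure (surface B C)"
  shows "(norm v)\<^sup>2 = 4 * B * (p $ 3)\<^sup>2 + (C + 2 * B) * (1 - (p $ 3)\<^sup>2)"
proof -
  let ?S = "{x. (norm (snd x))\<^sup>2 =
    4 * B * (fst x $ 3)\<^sup>2 + (C + 2 * B) * (1 - (fst x $ 3)\<^sup>2)} :: ((real^3) \<times> (real^3)) set"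
  have "closed ?S"
    by (intro closed_Collect_eq continuous_intros)
  moreover have "surface B C \<subseteq> ?S"
  proof
    fix x assume "x \<in> surface B C"
    then obtain s t c where xc: "x = line_at s t c"
      "c\<^sup>2 = 4 * B * (cos s)\<^sup>2 + (C + 2 * B) * (sin s)\<^sup>2"
      unfolding surface_eq[OF assms(1,2)] by blast
    have "(c * sin t)\<^sup>2 + (c * cos t)\<^sup>2 = c\<^sup>2 * ((sin t)\<^sup>2 + (cos t)\<^sup>2)"
      unfolding distrib_left power_mult_distrib ..
    then show "x \<in> ?S"
      using xc(2) zero_le_power2[of c] by (simp add: xc(1) line_at_def norm_vec3 sin_squared_eq)
  qed
  ultimately have "closure (surface B C) \<subseteq> ?S"
    by (simp add: closure_minimal)
  then show ?thesis using x by auto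
qed

text \<open>The displacement over the equator gives \<open>C + 2B\<close>; a further circle of latitude then gives
\<open>B\<close>.\<close>

lemma closure_surface_inj:
  assumes "B \<ge> 0" "- 2 * B \<le> C" "B' \<ge> 0" "- 2 * B' \<le> C'"
    and eq: "closure (surface B C) = closure (surface B' C')"
  shows "B = B' \<and> C = C'"
proof -
  have *: "4 * B * (cos s)\<^sup>2 + (C + 2 * B) * (1 - (cos s)\<^sup>2) =
      4 * B' * (cos s)\<^sup>2 + (C' + 2 * B') * (1 - (cos s)\<^sup>2)" if s: "sin s > 0" for s
  proof -
    define c where "c = sqrt (4 * B * (cos s)\<^sup>2 + (C + 2 * B) * (sin s)\<^sup>2)"
    have "4 * B * (cos s)\<^sup>2 + (C + 2 * B) * (sin s)\<^sup>2 \<ge> 0"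
      using assms(1,2) by simp
    then have "c\<^sup>2 = 4 * B * (cos s)\<^sup>2 + (C + 2 * B) * (sin s)\<^sup>2" by (simp add: c_def)
    then have "line_at s 0 c \<in> surface B C"
      using s unfolding surface_eq[OF assms(1,2)] by blast
    then have "line_at s 0 c \<in> closure (surface B C)" using closure_subset by blast
    then show ?thesis
      using closure_surface_length[OF assms(1,2)] closure_surface_length[OF assms(3,4)]
      unfolding eq line_at_def by fastforce
  qed
  have 1: "C + 2 * B = C' + 2 * B'" using *[of "pi/2"] by simp
  have c: "(cos (pi/4))\<^sup>2 = (1/2::real)" by (simp add: cos_45 power_divide)
  have s: "sin (pi/4) > (0::real)" by (simp add: sin_45)
  have "4 * B * (1/2) + (C + 2 * B) * (1 - 1/2) = 4 * B' * (1/2) + (C' + 2 * B') * (1 - 1/2)"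
    using *[OF s] unfolding c .
  with 1 show ?thesis by simp
qed

lemma Ck_on_line_at:
  assumes S: "open S" and "Ck_on n S s" "Ck_on n S t" "Ck_on n S c"
  shows "Ck_on n S (\<lambda>x. line_at (s x) (t x) (c x))"
proof -
  note sc = Ck_on_sin_cos[OF S assms(2)] Ck_on_sin_cos[OF S assms(3)]
  have "line_at s t c = (vec3 (sin s * cos t) (sin s * sin t) (cos s),
      vec3 ((-1) * c * sin t) (c * cos t) 0)" for s t c
    by (simp add: line_at_def)
  then show ?thesis
    by (simp only:) (intro Ck_on_vec3_pair[OF S] Ck_on_mult[OF S] Ck_on_const assms
        sc[THEN conjunct1] sc[THEN conjunct2])
qed

section \<open>The tori\<close>

lemma Ck_on_fst: "open S \<Longrightarrow> Ck_on n S (fst :: 'a::real_normed_vector \<times> 'b::real_normed_vector \<Rightarrow> 'a)"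
  using Ck_on_bounded_linear[OF bounded_linear_fst _ Ck_on_ident] .

lemma Ck_on_snd: "open S \<Longrightarrow> Ck_on n S (snd :: 'a::real_normed_vector \<times> 'b::real_normed_vector \<Rightarrow> 'b)"
  using Ck_on_bounded_linear[OF bounded_linear_snd _ Ck_on_ident] .

text \<open>The displacement \<open>h\<close> depends on the polar angle only, and \<open>s\<close> is taken modulo \<open>2\<pi>\<close>, so
that each circle of latitude is traversed for \<open>s\<close> and for \<open>-s\<close>.\<close>

definition torus_map :: "(real \<Rightarrow> real) \<Rightarrow> real \<times> real \<Rightarrow> (real^3) \<times> (real^3)"
  where "torus_map h x = line_at (fst x) (snd x) (h (fst x))"

text \<open>The derivative in \<open>s\<close> moves the direction \<open>p\<close> along a meridian.  The derivative in \<open>t\<close>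
moves \<open>p\<close> along the circle of latitude, except at the poles, where \<open>p\<close> is stationary but the
displacement rotates, being nonzero there.\<close>

lemma torus_map_immersion:
  assumes h: "smooth_on UNIV (\<lambda>x::real \<times> real. h (fst x))"
    and dh: "\<And>s. (h has_real_derivative h' s) (at s)"
    and per: "\<And>s. h (s + 2 * pi) = h s"
    and pole: "\<And>s. sin s = 0 \<Longrightarrow> h s \<noteq> 0"
  shows "torus_immersion (torus_map h)"
  unfolding torus_immersion_def
proof (intro conjI allI)
  show "smooth_on UNIV (torus_map h)"
    using h unfolding smooth_on_def torus_map_def[abs_def]
    by (intro allI Ck_on_line_at Ck_on_fst Ck_on_snd) auto
  show "torus_map h (s + 2 * pi, t) = torus_map h (s, t)"
    "torus_map h (s, t + 2 * pi) = torus_map h (s, t)" for s t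
    by (simp_all add: torus_map_def line_at_def per)
  fix x :: "real \<times> real"
  obtain s t where x: "x = (s, t)" by (cases x)
  let ?D = "\<lambda>v :: real \<times> real. (vec3 (cos s * cos t * fst v - sin s * sin t * snd v)
       (cos s * sin t * fst v + sin s * cos t * snd v) (- sin s * fst v),
     vec3 (- h' s * sin t * fst v - h s * cos t * snd v)
       (h' s * cos t * fst v - h s * sin t * snd v) 0)"
  have h1: "((\<lambda>x :: real \<times> real. h (fst x)) has_derivative (\<lambda>v. h' s * fst v)) (at (s, t))"
    using has_derivative_compose[where f = fst and g = h and x = "(s,t)" and s = UNIV and f' = fst]
      dh[of s] unfolding has_field_derivative_def
    by (simp add: has_derivative_fst[OF has_derivative_ident])
  have fs: "(fst has_derivative fst) (at (s, t))" "(snd has_derivative snd) (at (s, t))"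
    by (intro has_derivative_fst[OF has_derivative_ident] has_derivative_snd[OF has_derivative_ident])+
  have D: "(torus_map h has_derivative ?D) (at x)"
    unfolding x torus_map_def[abs_def] line_at_def
    by (intro has_derivative_vec3_pair)
       (auto intro!: derivative_eq_intros h1 fs simp: algebra_simps)
  have "linear ?D" using D by (rule has_derivative_linear)
  moreover have "v = 0" if "?D v = 0" for v
  proof -
    have zero: "(0 :: real^3) = vec3 0 0 0" by (simp add: vec_eq_iff forall_3)
    have e: "cos s * cos t * fst v = sin s * sin t * snd v"
      "cos s * sin t * fst v = - (sin s * cos t * snd v)" "sin s * fst v = 0"
      "- h' s * sin t * fst v = h s * cos t * snd v" "h' s * cos t * fst v = h s * sin t * snd v"
      using that by (auto simp: zero zero_prod_def)
    have sq: "(sin a)\<^sup>2 + (cos a)\<^sup>2 = 1" for a :: real by simp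
    have "cos s * fst v = cos s * fst v * ((sin t)\<^sup>2 + (cos t)\<^sup>2)" by (simp only: sq mult_1_right)
    also have "\<dots> = sin t * (cos s * sin t * fst v) + cos t * (cos s * cos t * fst v)"
      by algebra
    also have "\<dots> = 0" unfolding e by (simp add: algebra_simps)
    finally have "cos s * fst v = 0" .
    with e(3) have v1: "fst v = 0" using sin_zero_norm_cos_one[of s] by auto
    have "sin s * snd v = 0"
      using e(1,2) v1 sin_zero_norm_cos_one[of t] by auto
    moreover have "h s * snd v = 0"
      using e(4,5) v1 sin_zero_norm_cos_one[of t] by auto
    ultimately have "snd v = 0" using pole[of s] by auto
    with v1 show ?thesis by (simp add: prod_eq_iff)
  qed
  ultimately have "inj ?D" by (simp add: linear_injective_0)
  then show "inj (frechet_derivative (torus_map h) (at x))"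
    by (simp add: frechet_derivative_at[OF D, symmetric])
qed

text \<open>Where the displacement vector is nonzero it determines the longitude, and then the
direction determines \<open>sin s\<close> and \<open>cos s\<close>.\<close>

lemma torus_map_eq:
  assumes eq: "torus_map h x = torus_map h y" and h: "h (fst x) \<noteq> 0"
    and even: "\<And>a b. cos a = cos b \<Longrightarrow> h a = h b"
  shows "same_torus_point x y"
proof -
  obtain s t where x: "x = (s, t)" by (cases x)
  obtain s' t' where y: "y = (s', t')" by (cases y)
  have e: "sin s * cos t = sin s' * cos t'" "sin s * sin t = sin s' * sin t'" "cos s = cos s'"
    "h s * sin t = h s' * sin t'" "h s * cos t = h s' * cos t'"
    using eq by (auto simp: x y torus_map_def line_at_def)
  have "h s' = h s" using even e(3) by metis
  then have t: "sin t = sin t'" "cos t = cos t'" using e(4,5) h x by auto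
  have "sin s = sin s'"
  proof (cases "cos t' = 0")
    case True
    then have "sin t' \<noteq> 0" using sin_cos_squared_add[of t'] by auto
    then show ?thesis using e(2) t by simp
  next
    case False
    then show ?thesis using e(1) t by simp
  qed
  then obtain m :: int where m: "s' = s + 2 * pi * of_int m"
    using e(3) sin_cos_eq_iff[of s' s] by metis
  obtain n :: int where "t' = t + 2 * pi * of_int n"
    using t sin_cos_eq_iff[of t' t] by metis
  with m show ?thesis unfolding same_torus_point_def x y by auto
qed

lemma interior_sin_zero: "interior {x :: real \<times> real. sin (fst x + c) = 0} = {}"
proof -
  have "interior {s :: real. sin (s + c) = 0} = {}"
  proof (rule ccontr)
    assume "interior {s :: real. sin (s + c) = 0} \<noteq> {}"
    then obtain s where "s \<in> interior {s. sin (s + c) = 0}" by blast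
    then obtain e where e: "e > 0" "ball s e \<subseteq> {s. sin (s + c) = 0}"
      by (auto simp: mem_interior)
    \<comment> \<open>A step shorter than \<open>\<pi>\<close> cannot lead from one zero of the sine to another.\<close>
    define d where "d = min (e / 2) 1"
    have d: "0 < d" "d < pi" "d < e" using e(1) pi_gt3 by (auto simp: d_def)
    have "s \<in> ball s e" "s + d \<in> ball s e" using d e(1) by (auto simp: dist_real_def)
    then have "sin (s + c) = 0" "sin (s + d + c) = 0" using e(2) by blast+
    moreover have "s + d + c = (s + c) + d" by simp
    ultimately have "cos (s + c) * sin d = 0" by (metis sin_add add.left_neutral mult_zero_left)
    then show False
      using sin_gt_zero[OF d(1,2)] \<open>sin (s + c) = 0\<close> sin_cos_squared_add[of "s + c"] by auto
  qed
  moreover have "{x :: real \<times> real. sin (fst x + c) = 0} = {s. sin (s + c) = 0} \<times> UNIV" by auto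
  ultimately show ?thesis by (simp add: interior_Times)
qed

text \<open>The range is compact, and the points over the poles, which are the only ones not on the
two graphs, are limits of others.  The function \<open>h\<close> may be any continuous choice of root that
depends on \<open>cos s\<close> alone: then \<open>h(-s) = h(s)\<close>, and the parameters with \<open>sin s > 0\<close> and
\<open>sin s < 0\<close> give the two opposite displacements.\<close>

lemma range_torus_map:
  assumes B: "B \<ge> 0" "- 2 * B \<le> C" and cont: "continuous_on UNIV h"
    and sq: "\<And>s. (h s)\<^sup>2 = 4 * B * (cos s)\<^sup>2 + (C + 2 * B) * (sin s)\<^sup>2"
    and even: "\<And>a b. cos a = cos b \<Longrightarrow> h a = h b"
  shows "range (torus_map h) = closure (surface B C)"
proof
  have cont': "continuous_on UNIV (torus_map h)"
  proof -
    have "Ck_on 0 UNIV (torus_map h)"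
      unfolding torus_map_def[abs_def]
      by (intro Ck_on_line_at Ck_on_fst Ck_on_snd)
         (auto intro!: continuous_on_compose2[OF cont] continuous_on_fst)
    then show ?thesis by simp
  qed
  have "x \<in> torus_map h ` {y. sin (fst y) \<noteq> 0}" if xs: "x \<in> surface B C" for x
  proof -
    obtain s t c where x: "x = line_at s t c" "sin s > 0"
      "c\<^sup>2 = 4 * B * (cos s)\<^sup>2 + (C + 2 * B) * (sin s)\<^sup>2"
      using xs unfolding surface_eq[OF B] by blast
    then have "c\<^sup>2 = (h s)\<^sup>2" by (simp add: sq)
    then consider "c = h s" | "- c = h s" by (auto simp: power2_eq_iff)
    then show ?thesis
    proof cases
      case 1
      then have "x = torus_map h (s, t)" by (simp add: x torus_map_def)
      then show ?thesis using x(2) by force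
    next
      case 2
      moreover have "h (- s) = h s" by (rule even) simp
      ultimately have "x = torus_map h (- s, t + pi)"
        using line_at_flip[of s t c] by (simp add: x torus_map_def)
      then show ?thesis using x(2) by force
    qed
  qed
  then have sub: "surface B C \<subseteq> torus_map h ` {y. sin (fst y) \<noteq> 0}" by blast
  have "torus_map h x \<in> torus_map h ` ({0..2*pi} \<times> {0..2*pi})" for x
  proof -
    obtain s t where x: "x = (s, t)" by (cases x)
    obtain s' where s': "0 \<le> s'" "s' \<le> 2 * pi" "cos s = cos s'" "sin s = sin s'"
      using sincos_total_2pi_le[of "cos s" "sin s"] by auto
    obtain t' where t': "0 \<le> t'" "t' \<le> 2 * pi" "cos t = cos t'" "sin t = sin t'"
      using sincos_total_2pi_le[of "cos t" "sin t"] by auto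
    have "h s = h s'" by (rule even) (fact s'(3))
    then have "torus_map h x = torus_map h (s', t')"
      by (simp add: x torus_map_def line_at_def s' t')
    then show ?thesis using s' t' by auto
  qed
  then have "range (torus_map h) = torus_map h ` ({0..2*pi} \<times> {0..2*pi})" by blast
  moreover have "compact (torus_map h ` ({0..2*pi} \<times> {0..2*pi}))"
    by (intro compact_continuous_image continuous_on_subset[OF cont'] compact_Times) auto
  ultimately have "closed (range (torus_map h))" by (simp add: compact_imp_closed)
  then show "closure (surface B C) \<subseteq> range (torus_map h)"
    using sub by (intro closure_minimal) auto
  have image: "torus_map h ` {y. sin (fst y) \<noteq> 0} \<subseteq> surface B C"
  proof
    fix x assume "x \<in> torus_map h ` {y. sin (fst y) \<noteq> 0}"
    then obtain s t where x: "x = line_at s t (h s)" and s: "sin s \<noteq> 0"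
      by (auto simp: torus_map_def)
    show "x \<in> surface B C"
    proof (cases "sin s > 0")
      case True
      then show ?thesis unfolding surface_eq[OF B] x using sq by blast
    next
      case False
      then have "sin (- s) > 0" using s by simp
      moreover have "x = line_at (- s) (t + pi) (- h s)" by (simp add: x line_at_flip)
      moreover have "(- h s)\<^sup>2 = 4 * B * (cos (- s))\<^sup>2 + (C + 2 * B) * (sin (- s))\<^sup>2"
        using sq[of s] by simp
      ultimately show ?thesis unfolding surface_eq[OF B] by blast
    qed
  qed
  have "closure {y :: real \<times> real. sin (fst y) \<noteq> 0} = UNIV"
    using interior_sin_zero[of 0] by (simp add: closure_interior Compl_eq)
  then have "range (torus_map h) = torus_map h ` closure {y. sin (fst y) \<noteq> 0}" by simp
  also have "\<dots> \<subseteq> closure (torus_map h ` {y. sin (fst y) \<noteq> 0})"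
    by (rule image_closure_subset[OF continuous_on_subset[OF cont' subset_UNIV]
          closed_closure closure_subset])
  also have "\<dots> \<subseteq> closure (surface B C)"
    by (rule closure_mono[OF image])
  finally show "range (torus_map h) \<subseteq> closure (surface B C)" .
qed

lemma closure_surface_embedded:
  assumes B: "B > 0" "- 2 * B < C"
  shows "embedded_torus (closure (surface B C))"
proof -
  let ?u = "\<lambda>s. 4 * B * (cos s)\<^sup>2 + (C + 2 * B) * (sin s)\<^sup>2"
  let ?h = "\<lambda>s. sqrt (?u s)"
  have u: "?u s > 0" for s
  proof (cases "cos s = 0")
    case True
    then have "sin s \<noteq> 0" using sin_cos_squared_add[of s] by auto
    then show ?thesis using B True by simp
  next
    case False
    then show ?thesis using B by (simp add: add_pos_nonneg)
  qed
  have "Ck_on n UNIV (\<lambda>x :: real \<times> real. ?u (fst x))" for n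
    unfolding power2_eq_square
    by (intro Ck_on_add Ck_on_mult Ck_on_const Ck_on_sin_cos[THEN conjunct1]
        Ck_on_sin_cos[THEN conjunct2] Ck_on_fst open_UNIV)
  then have smooth: "smooth_on UNIV (\<lambda>x :: real \<times> real. ?h (fst x))"
    unfolding smooth_on_def by (intro allI Ck_on_sqrt u open_UNIV)
  have even: "?h a = ?h b" if "cos a = cos b" for a b
    using that by (simp add: sin_squared_eq)
  have deriv: "(?h has_real_derivative ((C - 2 * B) * sin s * cos s / ?h s)) (at s)" for s
    using u[of s] by (auto intro!: derivative_eq_intros simp: field_simps)
  have cont: "continuous_on UNIV ?h"
    by (intro continuous_intros)
  have nonzero: "?h s \<noteq> 0" for s using u[of s] by simp
  have imm: "torus_immersion (torus_map ?h)"
    by (rule torus_map_immersion[OF smooth deriv _ nonzero]) simp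
  have rng: "range (torus_map ?h) = closure (surface B C)"
    using B u by (intro range_torus_map cont even) (auto simp: less_imp_le)
  have "same_torus_point x y" if "torus_map ?h x = torus_map ?h y" for x y
  proof (rule torus_map_eq[OF that _ even])
    show "?h (fst x) \<noteq> 0" by (rule nonzero)
  qed
  moreover have "closure (surface B C) \<subseteq> TS2"
    unfolding rng[symmetric] by (auto simp: torus_map_def line_at_in_TS2)
  ultimately show ?thesis
    unfolding embedded_torus_def using imm rng by blast
qed

lemma embedded_imp_immersed: "embedded_torus T \<Longrightarrow> immersed_torus T"
  unfolding embedded_torus_def immersed_torus_def
  by (metis closed_empty empty_iff interior_empty)

text \<open>In the limiting case \<open>C = -2B\<close> the radicand is the square of \<open>2 \<surd>B cos s\<close>.  This signed
root is smooth, unlike its modulus; the torus crosses itself exactly where it vanishes.\<close>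

lemma closure_surface_immersed:
  assumes B: "B > 0" "- 2 * B \<le> C"
  shows "immersed_torus (closure (surface B C))"
proof (cases "C = - 2 * B")
  case False
  then show ?thesis
    using B by (intro embedded_imp_immersed closure_surface_embedded) auto
next
  case True
  let ?h = "\<lambda>s. 2 * sqrt B * cos s"
  have smooth: "smooth_on UNIV (\<lambda>x :: real \<times> real. ?h (fst x))"
    unfolding smooth_on_def
    by (intro allI Ck_on_mult Ck_on_const Ck_on_sin_cos[THEN conjunct2] Ck_on_fst open_UNIV)
  have deriv: "(?h has_real_derivative (- 2 * sqrt B * sin s)) (at s)" for s
    by (auto intro!: derivative_eq_intros)
  have even: "?h a = ?h b" if "cos a = cos b" for a b
    using that by simp
  have "cos s \<noteq> 0" if "sin s = 0" for s :: real
    using that sin_cos_squared_add[of s] by auto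
  then have imm: "torus_immersion (torus_map ?h)"
    using B by (intro torus_map_immersion[OF smooth deriv]) auto
  have rng: "range (torus_map ?h) = closure (surface B C)"
    using B True by (intro range_torus_map even continuous_intros) (auto simp: power_mult_distrib)
  \<comment> \<open>The circles \<open>cos s = 0\<close>, where the torus meets itself.\<close>
  let ?N = "{x :: real \<times> real. sin (fst x + pi / 2) = 0}"
  have N: "closed ?N" by (intro closed_Collect_eq continuous_intros)
  have "same_torus_point x y" if "x \<notin> ?N" "torus_map ?h x = torus_map ?h y" for x y
  proof (rule torus_map_eq[OF that(2) _ even])
    show "?h (fst x) \<noteq> 0" using that(1) B by (simp add: sin_add)
  qed
  moreover have "closure (surface B C) \<subseteq> TS2"
    unfolding rng[symmetric] by (auto simp: torus_map_def line_at_in_TS2)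
  ultimately show ?thesis
    unfolding immersed_torus_def using imm rng N interior_sin_zero[of "pi/2"] by blast
qed

section \<open>Extension through the poles\<close>

lemma Ck_on_fst_power: "open S \<Longrightarrow> Ck_on n S (\<lambda>x :: real \<times> real. fst x ^ k)"
  by (induction k) (auto intro!: Ck_on_const Ck_on_mult Ck_on_fst)

text \<open>If \<open>B > 0\<close> the radicand is positive for \<open>|r| < 1\<close>.  If \<open>B = 0\<close> it is \<open>C r\<^sup>2\<close>, which
vanishes at the pole, but the root \<open>\<surd>C r\<close> taken with the sign of \<open>r\<close> is smooth.\<close>

lemma smooth_radial_extension:
  assumes B: "B \<ge> 0" "- 2 * B \<le> C"
  obtains f where "smooth_on ({-1<..<1} \<times> UNIV) (\<lambda>x :: real \<times> real. f (fst x))"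
    "\<And>r. 0 < r \<Longrightarrow> r < 1 \<Longrightarrow> f r = sqrt (B + C * r\<^sup>2 + B * r^4)"
proof (cases "B = 0")
  case True
  show ?thesis
  proof (rule that[of "\<lambda>r. sqrt C * r"])
    show "smooth_on ({-1<..<1} \<times> UNIV) (\<lambda>x :: real \<times> real. sqrt C * fst x)"
      unfolding smooth_on_def
      by (intro allI Ck_on_mult Ck_on_const Ck_on_fst open_Times) auto
  qed (auto simp: True real_sqrt_mult)
next
  case False
  let ?S = "{-1<..<1} \<times> UNIV :: (real \<times> real) set"
  have S: "open ?S" by (intro open_Times) auto
  have "B + C * (fst x)\<^sup>2 + B * fst x ^ 4 > 0" if "x \<in> ?S" for x
  proof -
    have "\<bar>fst x\<bar> < 1" using that by auto
    then have "(fst x)\<^sup>2 < 1" by (simp add: abs_square_less_1)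
    then show ?thesis
      unfolding radicand_sum_of_squares using B False by (intro add_pos_nonneg) auto
  qed
  moreover have "Ck_on n ?S (\<lambda>x. B + C * (fst x)\<^sup>2 + B * fst x ^ 4)" for n
    by (intro Ck_on_add[OF S] Ck_on_mult[OF S] Ck_on_const Ck_on_fst_power[OF S])
  ultimately show ?thesis
    by (intro that[of "\<lambda>r. sqrt (B + C * r\<^sup>2 + B * r^4)"])
       (auto simp only: smooth_on_def intro!: Ck_on_sqrt[OF S])
qed

text \<open>The graph in polar coordinates.  The factor \<open>a\<close> is \<open>1\<close> for the coordinate \<open>r = R\<close> near the
north pole and \<open>-1\<close> for \<open>r = 1/R\<close> near the south pole.\<close>

definition polar_map :: "real \<Rightarrow> (real \<Rightarrow> real) \<Rightarrow> real \<Rightarrow> real \<times> real \<Rightarrow> (real^3) \<times> (real^3)"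
  where "polar_map \<epsilon> f a x = (let w = 1 / (1 + (fst x)\<^sup>2); k = \<epsilon> * 2 * f (fst x) * w in
    (vec3 (2 * fst x * w * cos (snd x)) (2 * fst x * w * sin (snd x)) (a * (1 + (-1) * (fst x)\<^sup>2) * w),
     vec3 ((-1) * k * sin (snd x)) (k * cos (snd x)) 0))"

lemma polar_map_smooth:
  assumes S: "open S" and f: "smooth_on S (\<lambda>x :: real \<times> real. f (fst x))"
  shows "smooth_on S (polar_map \<epsilon> f a)"
  unfolding smooth_on_def
proof
  fix n
  have f': "Ck_on n S (\<lambda>x. f (fst x))" using f by (simp add: smooth_on_def)
  have w: "Ck_on n S (\<lambda>x. 1 / (1 + (fst x)\<^sup>2))"
    by (intro Ck_on_inverse[OF S] one_plus_pos Ck_on_add[OF S] Ck_on_const Ck_on_fst_power[OF S])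
  show "Ck_on n S (polar_map \<epsilon> f a)"
    unfolding polar_map_def[abs_def] Let_def
    by (intro Ck_on_vec3_pair[OF S] Ck_on_mult[OF S] Ck_on_add[OF S] Ck_on_const
        Ck_on_fst_power[OF S] Ck_on_fst[OF S] w f' Ck_on_sin_cos[OF S, THEN conjunct1]
        Ck_on_sin_cos[OF S, THEN conjunct2] Ck_on_snd[OF S])
qed

lemma polar_map_in_TS2:
  assumes "a\<^sup>2 = 1"
  shows "polar_map \<epsilon> f a x \<in> TS2"
proof -
  obtain r t where x: "x = (r, t)" by (cases x)
  define w where "w = 1 / (1 + r\<^sup>2)"
  have w: "w * (1 + r\<^sup>2) = 1" using one_plus_pos(2)[of r] by (simp add: w_def)
  have "(2 * r * w * cos t)\<^sup>2 + (2 * r * w * sin t)\<^sup>2 + (a * (1 - r\<^sup>2) * w)\<^sup>2 =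
      w\<^sup>2 * (4 * r\<^sup>2 * ((sin t)\<^sup>2 + (cos t)\<^sup>2) + a\<^sup>2 * (1 - r\<^sup>2)\<^sup>2)"
    by (simp only: power_mult_distrib distrib_left) (simp add: algebra_simps)
  also have "\<dots> = (w * (1 + r\<^sup>2))\<^sup>2"
    unfolding assms sin_cos_squared_add by (simp add: power2_eq_square algebra_simps)
  finally have "(2 * r * w * cos t)\<^sup>2 + (2 * r * w * sin t)\<^sup>2 + (a * (1 - r\<^sup>2) * w)\<^sup>2 = 1"
    by (simp add: w)
  then show ?thesis
    by (simp add: TS2_def polar_map_def Let_def x w_def[symmetric] norm_vec3 inner_vec3)
qed

text \<open>The radicand is palindromic, \<open>f(1/r) = f(r) / r\<^sup>2\<close>, so the reflection \<open>R \<mapsto> 1/R\<close> in the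
equator only changes the sign of the third coordinate of the direction.  The extension through
infinity has the same formula as the one through zero.\<close>

lemma Fsec_extends:
  assumes B: "B \<ge> 0" "- 2 * B \<le> C"
  shows "extends_through_zero (Fsec \<epsilon> B C)" "extends_through_infinity (Fsec \<epsilon> B C)"
proof -
  obtain f where f: "smooth_on ({-1<..<1} \<times> UNIV) (\<lambda>x :: real \<times> real. f (fst x))"
    and feq: "\<And>r. 0 < r \<Longrightarrow> r < 1 \<Longrightarrow> f r = sqrt (B + C * r\<^sup>2 + B * r^4)"
    by (rule smooth_radial_extension[OF B]) (rule that)
  have sm: "smooth_on ({-1<..<1} \<times> UNIV) (polar_map \<epsilon> f a)" for a
    by (intro polar_map_smooth f open_Times) auto
  have "polar_map \<epsilon> f 1 (r, \<theta>) = line_of (rcis r \<theta>) (Fsec \<epsilon> B C (rcis r \<theta>))"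
    if "0 < r" "r < 1" for r \<theta>
    unfolding line_of_Fsec_polar[OF that(1)] polar_map_def using that by (simp add: feq)
  with sm[of 1] show "extends_through_zero (Fsec \<epsilon> B C)"
    unfolding extends_through_zero_def
    by (intro exI[of _ 1] exI[of _ "polar_map \<epsilon> f 1"] conjI) (auto simp: polar_map_in_TS2)
  have "polar_map \<epsilon> f (-1) (r, \<theta>) = line_of (rcis (1 / r) \<theta>) (Fsec \<epsilon> B C (rcis (1 / r) \<theta>))"
    if r: "0 < r" "r < 1" for r \<theta>
  proof -
    have r': "1 / r > 0" using r by simp
    have q: "1 + (1 / r)\<^sup>2 = (1 + r\<^sup>2) / r\<^sup>2" using r by (simp add: field_simps)
    have "B + C * (1 / r)\<^sup>2 + B * (1 / r)^4 = (B + C * r\<^sup>2 + B * r^4) / (r\<^sup>2)\<^sup>2"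
      using r by (simp add: field_simps power2_eq_square power4_eq_xxxx)
    then have "sqrt (B + C * (1 / r)\<^sup>2 + B * (1 / r)^4) = f r / r\<^sup>2"
      by (simp only: real_sqrt_divide feq[OF r] real_sqrt_abs abs_of_nonneg[OF zero_le_power2])
    then have k: "2 * sqrt (B + C * (1 / r)\<^sup>2 + B * (1 / r)^4) / (1 + (1 / r)\<^sup>2) = 2 * f r / (1 + r\<^sup>2)"
      unfolding q using r by simp
    have s: "2 * (1 / r) / (1 + (1 / r)\<^sup>2) = 2 * r / (1 + r\<^sup>2)"
      unfolding q using r by (simp add: power2_eq_square)
    have c: "(1 - (1 / r)\<^sup>2) / (1 + (1 / r)\<^sup>2) = - (1 - r\<^sup>2) / (1 + r\<^sup>2)"
    proof -
      have "1 - (1 / r)\<^sup>2 = - (1 - r\<^sup>2) / r\<^sup>2" using r by (simp add: field_simps)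
      then show ?thesis unfolding q using r by simp
    qed
    show ?thesis
      unfolding line_of_Fsec_polar[OF r'] k s c by (simp add: polar_map_def)
  qed
  with sm[of "-1"] show "extends_through_infinity (Fsec \<epsilon> B C)"
    unfolding extends_through_infinity_def
    by (intro exI[of _ 1] exI[of _ "polar_map \<epsilon> f (-1)"] conjI) (auto simp: polar_map_in_TS2)
qed

section \<open>Differentiating the area under the integral\<close>

text \<open>With \<open>y = \<surd>(1 + p)\<close> the error is exactly \<open>(y - 1)\<^sup>2 / 2\<close>, and \<open>p = (y - 1) (y + 1)\<close> with
\<open>y + 1 \<ge> 1\<close>.\<close>

lemma sqrt_one_plus_bound:
  fixes p :: real
  assumes "p \<ge> -1"
  shows "\<bar>sqrt (1 + p) - 1 - p / 2\<bar> \<le> p\<^sup>2 / 2"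
proof -
  define y where "y = sqrt (1 + p)"
  have y: "y \<ge> 0" "y\<^sup>2 = 1 + p" using assms by (auto simp: y_def)
  have p: "p = (y - 1) * (y + 1)" using y(2) by (simp add: power2_eq_square algebra_simps)
  have "y - 1 - p / 2 = - ((y - 1)\<^sup>2 / 2)"
    using y(2) by (simp add: power2_eq_square field_simps)
  moreover have "(y - 1)\<^sup>2 \<le> (y - 1)\<^sup>2 * (y + 1)\<^sup>2"
    using y(1) by (simp add: mult_le_cancel_left1 one_le_power)
  then have "(y - 1)\<^sup>2 \<le> p\<^sup>2" by (simp add: p power_mult_distrib)
  ultimately show ?thesis by (simp add: y_def[symmetric])
qed

text \<open>A second-order Taylor estimate whose constant depends only on the bounds \<open>m\<close> and \<open>M\<close>; it
is used uniformly over the domain of integration.\<close>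

lemma sqrt_quadratic_bound:
  fixes a b c t m M :: real
  assumes m: "0 < m" "m \<le> \<bar>a\<bar>" and M: "\<bar>a\<bar> \<le> M" "\<bar>b\<bar> \<le> M" "\<bar>c\<bar> \<le> M"
    and t: "\<bar>t\<bar> \<le> 1" "\<bar>t\<bar> * (2 * M / m) \<le> 1"
  shows "\<bar>sqrt \<bar>a + b * t + c * t\<^sup>2\<bar> - sqrt \<bar>a\<bar> - t * (sgn a * b / (2 * sqrt \<bar>a\<bar>))\<bar>
    \<le> sqrt M * (M / m + (2 * M / m)\<^sup>2) * t\<^sup>2"
proof -
  have M0: "M > 0" using m M by linarith
  have a: "a \<noteq> 0" using m by auto
  define p where "p = (b * t + c * t\<^sup>2) / a"
  have "\<bar>b * t + c * t\<^sup>2\<bar> \<le> \<bar>b\<bar> * \<bar>t\<bar> + \<bar>c\<bar> * t\<^sup>2"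
    by (metis abs_mult abs_power2 abs_triangle_ineq)
  also have "\<dots> \<le> M * \<bar>t\<bar> + M * \<bar>t\<bar>"
  proof (intro add_mono mult_mono)
    have "\<bar>t\<bar> * \<bar>t\<bar> \<le> \<bar>t\<bar> * 1" by (intro mult_left_mono t) auto
    then show "t\<^sup>2 \<le> \<bar>t\<bar>" by (simp add: power2_eq_square)
  qed (use M M0 in auto)
  finally have num: "\<bar>b * t + c * t\<^sup>2\<bar> \<le> 2 * M * \<bar>t\<bar>" by simp
  have "\<bar>p\<bar> \<le> (2 * M * \<bar>t\<bar>) / m"
    unfolding p_def abs_divide using num m M0 by (intro frac_le) auto
  then have p: "\<bar>p\<bar> \<le> \<bar>t\<bar> * (2 * M / m)" by (simp add: mult.commute)
  then have p1: "p \<ge> -1" using t(2) by linarith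
  have "p\<^sup>2 \<le> (\<bar>t\<bar> * (2 * M / m))\<^sup>2"
    using p by (metis abs_ge_zero power2_abs power_mono)
  then have p2: "p\<^sup>2 \<le> (2 * M / m)\<^sup>2 * t\<^sup>2" by (simp add: power_mult_distrib power_divide mult.commute)
  have "a + b * t + c * t\<^sup>2 = a * (1 + p)" using a by (simp add: p_def field_simps)
  then have s: "sqrt \<bar>a + b * t + c * t\<^sup>2\<bar> = sqrt \<bar>a\<bar> * sqrt (1 + p)"
    using p1 by (simp add: abs_mult real_sqrt_mult)
  have e1: "sgn a * b / (2 * sqrt \<bar>a\<bar>) = sqrt \<bar>a\<bar> * (b / (2 * a))"
  proof -
    have "a = sgn a * (sqrt \<bar>a\<bar> * sqrt \<bar>a\<bar>)" by (simp add: mult_sgn_abs)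
    then have "sqrt \<bar>a\<bar> * (b / (2 * a)) = sqrt \<bar>a\<bar> * (b / (2 * (sgn a * (sqrt \<bar>a\<bar> * sqrt \<bar>a\<bar>))))"
      by simp
    also have "\<dots> = sgn a * b / (2 * sqrt \<bar>a\<bar>)"
      using a by (simp add: field_simps sgn_if)
    finally show ?thesis by simp
  qed
  have "p / 2 - c * t\<^sup>2 / (2 * a) = t * (b / (2 * a))"
    using a by (simp add: p_def field_simps)
  then have "t * (sgn a * b / (2 * sqrt \<bar>a\<bar>)) = sqrt \<bar>a\<bar> * (p / 2 - c * t\<^sup>2 / (2 * a))"
    unfolding e1 by simp
  then have eq: "sqrt \<bar>a + b * t + c * t\<^sup>2\<bar> - sqrt \<bar>a\<bar> - t * (sgn a * b / (2 * sqrt \<bar>a\<bar>)) =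
      sqrt \<bar>a\<bar> * ((sqrt (1 + p) - 1 - p / 2) + c * t\<^sup>2 / (2 * a))"
    unfolding s by (simp add: algebra_simps)
  have "\<bar>c * t\<^sup>2 / (2 * a)\<bar> \<le> (M * t\<^sup>2) / (1 * m)"
    unfolding abs_divide abs_mult using M m by (intro frac_le mult_mono) auto
  then have "\<bar>(sqrt (1 + p) - 1 - p / 2) + c * t\<^sup>2 / (2 * a)\<bar> \<le> M * t\<^sup>2 / m + (2 * M / m)\<^sup>2 * t\<^sup>2"
    using sqrt_one_plus_bound[OF p1] p2 zero_le_power2[of p] by linarith
  then have "\<bar>(sqrt (1 + p) - 1 - p / 2) + c * t\<^sup>2 / (2 * a)\<bar> \<le> (M / m + (2 * M / m)\<^sup>2) * t\<^sup>2"
    by (simp add: distrib_right)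
  then show ?thesis
    unfolding eq abs_mult mult.assoc using M M0 by (intro mult_mono) auto
qed

lemma set_integrable_continuous_compact:
  fixes f :: "'a::euclidean_space \<Rightarrow> real"
  shows "compact K \<Longrightarrow> continuous_on K f \<Longrightarrow> set_integrable lborel K f"
  unfolding set_integrable_def by (rule borel_integrable_compact)

lemma has_derivative_sqrt_quadratic_integral:
  fixes a b c :: "'a::euclidean_space \<Rightarrow> real"
  assumes K: "compact K" and cont: "continuous_on K a" "continuous_on K b" "continuous_on K c"
    and nz: "\<And>x. x \<in> K \<Longrightarrow> a x \<noteq> 0"
  shows "((\<lambda>t. LINT x:K|lborel. sqrt \<bar>a x + b x * t + c x * t\<^sup>2\<bar>) has_real_derivative
    (LINT x:K|lborel. sgn (a x) * b x / (2 * sqrt \<bar>a x\<bar>))) (at 0)"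
proof (cases "K = {}")
  case True
  then show ?thesis by (simp add: set_lebesgue_integral_def)
next
  case False
  have bound: "\<exists>N. \<forall>x\<in>K. \<bar>f x\<bar> \<le> N" if f: "continuous_on K f" for f :: "'a \<Rightarrow> real"
    using compact_imp_bounded[OF compact_continuous_image[OF f K]]
    by (auto simp: bounded_iff)
  obtain N1 N2 N3 where N: "\<forall>x\<in>K. \<bar>a x\<bar> \<le> N1" "\<forall>x\<in>K. \<bar>b x\<bar> \<le> N2" "\<forall>x\<in>K. \<bar>c x\<bar> \<le> N3"
    using bound[OF cont(1)] bound[OF cont(2)] bound[OF cont(3)] by blast
  define M where "M = max N1 (max N2 N3)"
  have M: "\<bar>a x\<bar> \<le> M" "\<bar>b x\<bar> \<le> M" "\<bar>c x\<bar> \<le> M" if "x \<in> K" for x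
    using N that by (force simp: M_def)+
  obtain x0 where x0: "x0 \<in> K" "\<forall>x\<in>K. \<bar>a x0\<bar> \<le> \<bar>a x\<bar>"
    using continuous_attains_inf[OF K False continuous_on_rabs[OF cont(1)]] by blast
  define m where "m = \<bar>a x0\<bar>"
  have m: "m > 0" "\<And>x. x \<in> K \<Longrightarrow> m \<le> \<bar>a x\<bar>" using x0 nz by (auto simp: m_def)
  have M0: "M > 0" using M(1)[OF x0(1)] m(1) by (simp add: m_def)
  define N where "N = sqrt M * (M / m + (2 * M / m)\<^sup>2)"
  define L where "L = (\<lambda>x. sgn (a x) * b x / (2 * sqrt \<bar>a x\<bar>))"
  have contsgn: "L x = b x * (a x / \<bar>a x\<bar>) / (2 * sqrt \<bar>a x\<bar>)" for x
    by (simp add: L_def sgn_if)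
  have contL: "continuous_on K L"
    unfolding contsgn by (intro continuous_intros cont) (use nz in auto)
  define f where "f t x = sqrt \<bar>a x + b x * t + c x * t\<^sup>2\<bar>" for t x
  define rem where "rem t x = f t x - f 0 x - t * L x" for t x
  let ?I = "set_lebesgue_integral lborel K"
  have contf: "continuous_on K (f t)" for t
    unfolding f_def[abs_def] by (intro continuous_intros cont)
  have int_f: "set_integrable lborel K (f t)" and int_L: "set_integrable lborel K L" for t
    by (intro set_integrable_continuous_compact K contf contL)+
  have int_rem: "set_integrable lborel K (rem t)" for t
    unfolding rem_def[abs_def]
    by (intro set_integrable_continuous_compact K continuous_intros contf contL)
  have rem: "?I (f t) - ?I (f 0) - t * ?I L = ?I (rem t)" for t
    using int_f int_L unfolding rem_def[abs_def] by (simp add: set_integral_diff)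
  have est: "\<bar>?I (f t) - ?I (f 0) - t * ?I L\<bar> \<le> ?I (\<lambda>x. N) * t\<^sup>2"
    if t: "\<bar>t\<bar> \<le> 1" "\<bar>t\<bar> * (2 * M / m) \<le> 1" for t
  proof -
    have "\<bar>?I (rem t)\<bar> \<le> ?I (\<lambda>x. \<bar>rem t x\<bar>)"
      using set_integral_norm_bound[OF int_rem[of t]] by (simp only: real_norm_def)
    also have "\<dots> \<le> ?I (\<lambda>x. N * t\<^sup>2)"
    proof (rule set_integral_mono)
      show "set_integrable lborel K (\<lambda>x. \<bar>rem t x\<bar>)"
        by (rule set_integrable_abs[OF int_rem])
      show "set_integrable lborel K (\<lambda>x. N * t\<^sup>2)"
        by (intro set_integrable_continuous_compact K continuous_intros)
      show "\<bar>rem t x\<bar> \<le> N * t\<^sup>2" if "x \<in> K" for x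
        using sqrt_quadratic_bound[OF m(1) m(2)[OF that] M[OF that] t]
        by (simp add: rem_def f_def L_def N_def)
    qed
    also have "\<dots> = ?I (\<lambda>x. N) * t\<^sup>2" by (rule set_integral_mult_left)
    finally show ?thesis unfolding rem .
  qed
  define N' where "N' = ?I (\<lambda>x. N)"
  define \<tau> where "\<tau> = min 1 (m / (2 * M))"
  have tau: "\<tau> > 0" using m(1) M0 by (simp add: \<tau>_def)
  have "((\<lambda>h. (?I (f (0 + h)) - ?I (f 0)) / h) \<longlongrightarrow> ?I L) (at 0)"
  proof (rule LIM_zero_cancel, rule Lim_null_comparison)
    show "\<forall>\<^sub>F h in at 0. norm ((?I (f (0 + h)) - ?I (f 0)) / h - ?I L) \<le> N' * \<bar>h\<bar>"
      unfolding eventually_at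
    proof (intro exI[of _ \<tau>] conjI tau ballI impI)
      fix h :: real assume h: "h \<noteq> 0 \<and> dist h 0 < \<tau>"
      then have "\<bar>h\<bar> \<le> 1" "\<bar>h\<bar> < m / (2 * M)" by (auto simp: \<tau>_def)
      then have "\<bar>h\<bar> * (2 * M / m) \<le> 1"
        using m(1) M0 by (simp add: field_simps)
      with \<open>\<bar>h\<bar> \<le> 1\<close> have "\<bar>?I (f h) - ?I (f 0) - h * ?I L\<bar> \<le> N' * h\<^sup>2"
        unfolding N'_def by (rule est)
      then have "\<bar>?I (f h) - ?I (f 0) - h * ?I L\<bar> / \<bar>h\<bar> \<le> N' * h\<^sup>2 / \<bar>h\<bar>"
        by (rule divide_right_mono) simp
      moreover have "(?I (f (0 + h)) - ?I (f 0)) / h - ?I L =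
          (?I (f h) - ?I (f 0) - h * ?I L) / h"
        using h by (simp add: field_simps)
      moreover have "N' * h\<^sup>2 / \<bar>h\<bar> = N' * \<bar>h\<bar>"
        using h by (simp add: power2_eq_square abs_if)
      ultimately show "norm ((?I (f (0 + h)) - ?I (f 0)) / h - ?I L) \<le> N' * \<bar>h\<bar>"
        by (simp only: real_norm_def abs_divide)
    qed
    show "((\<lambda>h. N' * \<bar>h\<bar>) \<longlongrightarrow> 0) (at (0::real))"
      by (auto intro!: tendsto_eq_intros)
  qed
  then show ?thesis
    unfolding DERIV_def L_def f_def .
qed

section \<open>Integrals of directional derivatives\<close>

text \<open>The difference quotients of \<open>g\<close> in the direction \<open>v\<close> have integral zero by translation
invariance.  They are dominated by a multiple of the indicator of a ball, by the mean value
theorem, so their limit, the directional derivative, has integral zero as well.\<close>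

lemma integral_directional_derivative_zero:
  fixes g :: "'a::euclidean_space \<Rightarrow> real"
  assumes K: "compact K" and U: "open U" "K \<subseteq> U"
    and D: "\<And>x. x \<in> U \<Longrightarrow> (g has_derivative D x) (at x)"
    and cont: "continuous_on U (\<lambda>x. D x v)"
    and zero: "\<And>x. x \<notin> K \<Longrightarrow> g x = 0"
  shows "(LINT x:K|lborel. D x v) = 0"
proof -
  define d where "d x = indicator K x * D x v" for x
  have D0: "(g has_derivative (\<lambda>_. 0)) (at x)" if "x \<notin> K" for x
  proof -
    have o: "open (- K)" using K by (simp add: compact_imp_closed open_Compl)
    have "((\<lambda>_. 0) has_derivative (\<lambda>_. 0)) (at x)" by simp
    then show ?thesis
      by (rule has_derivative_transform_within_open[OF _ o]) (use that zero in auto)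
  qed
  define D' where "D' x = (if x \<in> K then D x else (\<lambda>_. 0))" for x
  have D': "(g has_derivative D' x) (at x)" for x
    using D D0 U(2) by (auto simp: D'_def)
  have D'v: "D' x v = d x" for x by (simp add: D'_def d_def)
  have line: "((\<lambda>t. g (x + t *\<^sub>R v)) has_real_derivative d (x + t *\<^sub>R v)) (at t)" for x t
  proof -
    have "((\<lambda>t. x + t *\<^sub>R v) has_derivative (\<lambda>h. h *\<^sub>R v)) (at t)"
      by (auto intro!: derivative_eq_intros)
    from has_derivative_compose[OF this D'[of "x + t *\<^sub>R v"]]
    have "((\<lambda>t. g (x + t *\<^sub>R v)) has_derivative (\<lambda>h. D' (x + t *\<^sub>R v) (h *\<^sub>R v))) (at t)" .
    moreover have "D' y (h *\<^sub>R v) = d y * h" for y h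
      using linear_scale[OF has_derivative_linear[OF D'[of y]], of h v] by (simp add: D'v)
    ultimately show ?thesis by (simp add: has_field_derivative_def)
  qed
  have contK: "continuous_on K (\<lambda>x. D x v)" by (rule continuous_on_subset[OF cont U(2)])
  obtain M where "\<forall>x\<in>K. \<bar>D x v\<bar> \<le> M"
    using compact_imp_bounded[OF compact_continuous_image[OF contK K]] by (auto simp: bounded_iff)
  then have M: "\<bar>d x\<bar> \<le> \<bar>M\<bar>" for x
    by (cases "x \<in> K") (auto simp: d_def)
  have contg: "continuous_on UNIV g"
    using D' by (meson continuous_at_imp_continuous_on has_derivative_continuous)
  have "indicator K x *\<^sub>R g x = g x" for x using zero by (cases "x \<in> K") auto
  then have intg: "integrable lborel g"
    using borel_integrable_compact[OF K continuous_on_subset[OF contg subset_UNIV]] by (simp only:)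
  have intd: "integrable lborel d"
    using borel_integrable_compact[OF K contK] by (simp add: d_def[abs_def])
  obtain r where r: "\<And>x. x \<in> K \<Longrightarrow> norm x \<le> r"
    using compact_imp_bounded[OF K] by (auto simp: bounded_iff)
  define T where "T = cball (0::'a) (r + norm v)"
  define s where "s n x = (g (x + (1 / real (Suc n)) *\<^sub>R v) - g x) * real (Suc n)" for n x
  have s_int: "integral\<^sup>L lborel (s n) = 0" for n
  proof -
    let ?w = "(1 / real (Suc n)) *\<^sub>R v"
    have meas: "g \<in> borel_measurable borel" using contg by (rule borel_measurable_continuous_onI)
    have 1: "integral\<^sup>L lborel (\<lambda>x. g (?w + x)) = integral\<^sup>L lborel g"
      by (subst (2) lborel_distr_plus[of ?w, symmetric]) (subst integral_distr, use meas in auto)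
    have 2: "integrable lborel (\<lambda>x. g (?w + x))"
      using intg by (subst (asm) lborel_distr_plus[of ?w, symmetric])
        (subst (asm) integrable_distr_eq, use meas in auto)
    show ?thesis
      using 1 2 intg by (simp add: s_def[abs_def] add.commute)
  qed
  have "(\<lambda>n. integral\<^sup>L lborel (s n)) \<longlonglongrightarrow> integral\<^sup>L lborel d"
  proof (rule integral_dominated_convergence[where w = "\<lambda>x. indicator T x *\<^sub>R \<bar>M\<bar>"])
    show "d \<in> borel_measurable lborel" using intd by simp
    have "g \<in> borel_measurable borel" using contg by (rule borel_measurable_continuous_onI)
    then show "s n \<in> borel_measurable lborel" for n
      unfolding s_def[abs_def] by measurable
    show "integrable lborel (\<lambda>x. indicator T x *\<^sub>R \<bar>M\<bar>)"
      unfolding T_def by (intro borel_integrable_compact) auto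
    show "AE x in lborel. (\<lambda>n. s n x) \<longlonglongrightarrow> d x"
    proof (rule AE_I2)
      fix x :: 'a
      have "((\<lambda>h. (g (x + (0 + h) *\<^sub>R v) - g (x + 0 *\<^sub>R v)) / h) \<longlongrightarrow> d x) (at 0)"
        using line[of x 0] by (simp add: DERIV_def)
      then have "((\<lambda>h. (g (x + h *\<^sub>R v) - g x) / h) \<longlongrightarrow> d x) (at 0)" by simp
      moreover have "filterlim (\<lambda>n. 1 / real (Suc n)) (at 0) sequentially"
        unfolding filterlim_at using lim_1_over_n[THEN LIMSEQ_Suc] by auto
      ultimately have "(\<lambda>n. (g (x + (1 / real (Suc n)) *\<^sub>R v) - g x) / (1 / real (Suc n))) \<longlonglongrightarrow> d x"
        by (rule filterlim_compose)
      then show "(\<lambda>n. s n x) \<longlonglongrightarrow> d x" by (simp add: s_def)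
    qed
    show "AE x in lborel. norm (s n x) \<le> indicator T x *\<^sub>R \<bar>M\<bar>" for n
    proof (rule AE_I2)
      fix x :: 'a
      define e where "e = 1 / real (Suc n)"
      have e: "0 < e" "e \<le> 1" "real (Suc n) * e = 1" by (auto simp: e_def)
      obtain z where "g (x + e *\<^sub>R v) - g (x + 0 *\<^sub>R v) = (e - 0) * d (x + z *\<^sub>R v)"
        using MVT2[of 0 e "\<lambda>t. g (x + t *\<^sub>R v)" "\<lambda>t. d (x + t *\<^sub>R v)"] line e(1) by blast
      then have "s n x = (real (Suc n) * e) * d (x + z *\<^sub>R v)"
        by (simp add: s_def e_def[symmetric] del: of_nat_Suc)
      then have b: "norm (s n x) \<le> \<bar>M\<bar>" using M e(3) by simp
      show "norm (s n x) \<le> indicator T x *\<^sub>R \<bar>M\<bar>"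
      proof (cases "x \<in> T")
        case True
        then show ?thesis using b by simp
      next
        case False
        then have n: "norm x > r + norm v" by (simp add: T_def)
        have "norm x > r" using n norm_ge_zero[of v] by linarith
        then have "x \<notin> K" using r[of x] by auto
        moreover have "norm (x + e *\<^sub>R v) > r"
        proof -
          have "norm (e *\<^sub>R v) \<le> norm v" using e by (simp add: mult_left_le_one_le)
          then show ?thesis using n norm_diff_ineq[of x "e *\<^sub>R v"] by linarith
        qed
        then have "x + e *\<^sub>R v \<notin> K" using r[of "x + e *\<^sub>R v"] by auto
        ultimately show ?thesis using zero by (simp add: s_def e_def[symmetric] del: of_nat_Suc)
      qed
    qed
  qed
  then have "integral\<^sup>L lborel d = 0"
    by (simp add: s_int LIMSEQ_const_iff)
  then show ?thesis by (simp add: set_lebesgue_integral_def d_def[abs_def])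
qed

section \<open>Rotationally symmetric sections\<close>

lemma norm_squared_off_circle:
  fixes \<xi> :: complex
  assumes "\<xi> \<noteq> 0" "norm \<xi> \<noteq> 1"
  shows "(norm \<xi>)\<^sup>2 > 0" "(norm \<xi>)\<^sup>2 \<noteq> 1"
  using assms by (auto simp: power2_eq_1_iff) (smt (verit) norm_ge_zero)

lemma norm_squared_has_derivative:
  "((\<lambda>z::complex. (norm z)\<^sup>2) has_derivative (\<lambda>v. 2 * inner \<xi> v)) (at \<xi>)"
  unfolding power2_norm_eq_inner
  by (auto intro!: derivative_eq_intros simp: inner_commute)

lemma radial_has_derivative:
  assumes "(g has_real_derivative g') (at ((norm \<xi>)\<^sup>2))"
  shows "((\<lambda>z::complex. g ((norm z)\<^sup>2)) has_derivative (\<lambda>v. g' * (2 * inner \<xi> v))) (at \<xi>)"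
  using has_derivative_compose[OF norm_squared_has_derivative
      assms[unfolded has_field_derivative_def]] by simp

lemma dconf_eq: "dconf \<xi> = - (8 / (1 + (norm \<xi>)\<^sup>2)^3) * cnj \<xi>"
proof -
  let ?q = "1 + (norm \<xi>)\<^sup>2"
  have "((\<lambda>q. 4 / (1 + q)\<^sup>2) has_real_derivative - 8 / ?q^3) (at ((norm \<xi>)\<^sup>2))"
    using one_plus_pos(1)[of \<xi>]
    by (auto intro!: derivative_eq_intros simp: divide_simps power2_eq_square power3_eq_cube)
  from has_derivative_of_real[OF radial_has_derivative[OF this]]
  have "((\<lambda>z. complex_of_real (conf z)) has_derivative
      (\<lambda>v. of_real (- 8 / ?q^3 * (2 * inner \<xi> v)))) (at \<xi>)"
    by (simp only: conf_def)
  then have "frechet_derivative (\<lambda>z. complex_of_real (conf z)) (at \<xi>) =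
      (\<lambda>v. of_real (- 8 / ?q^3 * (2 * inner \<xi> v)))"
    by (rule frechet_derivative_at[symmetric])
  then show ?thesis
    by (simp add: dconf_def wirt_def inner_complex_def complex_eq_iff)
qed

lemma christoffel_eq: "christoffel \<xi> = - of_real (2 / (1 + (norm \<xi>)\<^sup>2)) * cnj \<xi>"
proof -
  define p where "p = 1 + (norm \<xi>)\<^sup>2"
  have "p > 0" using one_plus_pos(1)[of \<xi>] by (simp add: p_def)
  moreover have "christoffel \<xi> = - (8 / of_real p ^ 3) * cnj \<xi> / (4 / of_real p ^ 2)"
    by (simp add: christoffel_def dconf_eq conf_def p_def)
  ultimately show ?thesis
    unfolding p_def[symmetric] by (simp add: field_simps power2_eq_square power3_eq_cube)
qed

text \<open>At \<open>z\<close> the value is \<open>g\<close> times the velocity of the rotation of the sphere about the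
vertical axis.\<close>

definition rot_section :: "(real \<Rightarrow> real) \<Rightarrow> complex \<Rightarrow> complex"
  where "rot_section g z = \<i> * of_real (g ((norm z)\<^sup>2)) * z"

lemma rot_section_has_derivative:
  assumes "(g has_real_derivative g') (at ((norm \<xi>)\<^sup>2))"
  shows "(rot_section g has_derivative
    (\<lambda>v. \<i> * (of_real (g ((norm \<xi>)\<^sup>2)) * v + of_real (g' * (2 * inner \<xi> v)) * \<xi>))) (at \<xi>)"
  unfolding rot_section_def[abs_def]
  by (auto intro!: derivative_eq_intros has_derivative_of_real radial_has_derivative[OF assms]
      simp: algebra_simps)

lemma lambda_sigma_rot_section:
  assumes g: "(g has_real_derivative g') (at q)" and q: "q = (norm \<xi>)\<^sup>2"
    and F: "(F has_derivative (\<lambda>v. \<i> * (of_real (g q) * v + of_real (g' * (2 * inner \<xi> v)) * \<xi>))) (at \<xi>)"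
    and F0: "F \<xi> = \<i> * of_real (g q) * \<xi>"
  shows "lambda F \<xi> = g q + q * g' - 2 * q * g q / (1 + q)"
    and "sigma F \<xi> = \<i> * of_real g' * (cnj \<xi>)\<^sup>2"
proof -
  have diff: "F differentiable (at \<xi>)" using F by (rule differentiableI)
  have D: "frechet_derivative F (at \<xi>) =
      (\<lambda>v. \<i> * (of_real (g q) * v + of_real (g' * (2 * inner \<xi> v)) * \<xi>))"
    using F by (rule frechet_derivative_at[symmetric])
  have qx: "q = Re \<xi> * Re \<xi> + Im \<xi> * Im \<xi>"
    using cmod_power2[of \<xi>] by (simp add: q power2_eq_square)
  have w: "wirt F \<xi> = \<i> * of_real (g q + q * g')"
    by (simp add: wirt_def D inner_complex_def complex_eq_iff qx algebra_simps)
  have "F \<xi> * christoffel \<xi> = - \<i> * of_real (2 * g q / (1 + q)) * (\<xi> * cnj \<xi>)"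
    by (simp add: F0 christoffel_eq q)
  also have "\<xi> * cnj \<xi> = of_real q" by (simp add: q complex_norm_square[symmetric])
  finally have "F \<xi> * christoffel \<xi> = - \<i> * of_real (2 * q * g q / (1 + q))" by simp
  then have "rho F \<xi> = \<i> * of_real (g q + q * g' - 2 * q * g q / (1 + q))"
    unfolding rho_alt[OF diff] w by (simp add: algebra_simps)
  then show "lambda F \<xi> = g q + q * g' - 2 * q * g q / (1 + q)"
    by (simp add: lambda_def)
  have "wirt_bar F \<xi> = \<i> * of_real g' * \<xi>\<^sup>2"
    by (simp add: wirt_bar_def D inner_complex_def complex_eq_iff power2_eq_square field_simps)
  then show "sigma F \<xi> = \<i> * of_real g' * (cnj \<xi>)\<^sup>2"
    by (simp add: sigma_alt[OF diff])
qed

section \<open>The induced metric of the family\<close>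

text \<open>With \<open>q = |\<xi>|\<^sup>2\<close> the section is \<open>\<epsilon> \<i> profile(q) \<xi>\<close>; the radicand in terms of \<open>R\<close> has been
divided by \<open>R\<^sup>2\<close> because \<open>\<xi>\<close> replaces the unit vector \<open>\<xi> / R\<close>.\<close>

definition profile :: "real \<Rightarrow> real \<Rightarrow> real \<Rightarrow> real"
  where "profile B C q = sqrt (B / q + C + B * q)"

definition profile' :: "real \<Rightarrow> real \<Rightarrow> real \<Rightarrow> real"
  where "profile' B C q = B * (1 - 1 / q\<^sup>2) / (2 * profile B C q)"

lemma Fsec_eq_rot_section:
  assumes "\<xi> \<noteq> 0"
  shows "Fsec \<epsilon> B C \<xi> = rot_section (\<lambda>q. \<epsilon> * profile B C q) \<xi>"
proof -
  define n where "n = norm \<xi>"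
  have n: "n > 0" using assms by (simp add: n_def)
  have "B / n\<^sup>2 + C + B * n\<^sup>2 = (B + C * n\<^sup>2 + B * n^4) / n\<^sup>2"
    using n by (simp add: field_simps power2_eq_square power4_eq_xxxx)
  then have "profile B C (n\<^sup>2) = sqrt (B + C * n\<^sup>2 + B * n^4) / n"
    using n by (simp add: profile_def real_sqrt_divide)
  then show ?thesis
    unfolding Fsec_def rot_section_def n_def[symmetric] sgn_eq by (simp add: n_def[symmetric])
qed

lemma profile_deriv:
  assumes "q > 0" "profile B C q > 0"
  shows "(profile B C has_real_derivative profile' B C q) (at q)"
proof -
  have "B / q + C + B * q > 0" using assms(2) by (simp add: profile_def)
  then show ?thesis
    unfolding profile_def[abs_def] profile'_def using assms(1)
    by (auto intro!: derivative_eq_intros simp: field_simps power2_eq_square)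
qed

lemma profile_squared:
  assumes "profile B C q > 0"
  shows "(profile B C q)\<^sup>2 = B / q + C + B * q"
  using assms by (simp add: profile_def)

lemma profile_pos:
  assumes "B \<ge> 0" "- 2 * B \<le> C" "q > 0" "q \<noteq> 1 \<or> - 2 * B < C" "B > 0 \<or> C > 0"
  shows "profile B C q > 0"
proof -
  have "B / q + C + B * q = (B * (1 - q)\<^sup>2 + (C + 2 * B) * q) / q"
    using assms(3) by (simp add: field_simps power2_eq_square)
  moreover have "B * (1 - q)\<^sup>2 + (C + 2 * B) * q > 0"
  proof (cases "- 2 * B < C")
    case True
    then show ?thesis using assms by (intro add_nonneg_pos) auto
  next
    case False
    then show ?thesis using assms by (intro add_pos_nonneg) auto
  qed
  ultimately show ?thesis using assms(3) by (simp add: profile_def)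
qed

lemma Fsec_has_derivative:
  assumes "\<xi> \<noteq> 0" and q: "q = (norm \<xi>)\<^sup>2" and pos: "profile B C q > 0"
  shows "(Fsec \<epsilon> B C has_derivative (\<lambda>v. \<i> * (of_real (\<epsilon> * profile B C q) * v
      + of_real (\<epsilon> * profile' B C q * (2 * inner \<xi> v)) * \<xi>))) (at \<xi>)"
proof -
  have "q > 0" using assms(1) q by simp
  then have "((\<lambda>q. \<epsilon> * profile B C q) has_real_derivative \<epsilon> * profile' B C q) (at q)"
    using profile_deriv[OF _ pos] by (auto intro!: derivative_eq_intros)
  from rot_section_has_derivative[OF this[unfolded q]]
  show ?thesis
    unfolding q by (rule has_derivative_transform_within_open[where s = "- {0}"])
      (use assms(1) in \<open>auto simp: Fsec_eq_rot_section\<close>)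
qed

lemma lambda_sigma_Fsec:
  assumes "\<xi> \<noteq> 0" and q: "q = (norm \<xi>)\<^sup>2" and pos: "profile B C q > 0"
  shows "lambda (Fsec \<epsilon> B C) \<xi> =
      \<epsilon> * (profile B C q + q * profile' B C q - 2 * q * profile B C q / (1 + q))"
    and "sigma (Fsec \<epsilon> B C) \<xi> = \<i> * of_real (\<epsilon> * profile' B C q) * (cnj \<xi>)\<^sup>2"
proof -
  have q0: "q > 0" using assms(1) q by simp
  have g: "((\<lambda>q. \<epsilon> * profile B C q) has_real_derivative \<epsilon> * profile' B C q) (at q)"
    using profile_deriv[OF q0 pos] by (auto intro!: derivative_eq_intros)
  have F0: "Fsec \<epsilon> B C \<xi> = \<i> * of_real (\<epsilon> * profile B C q) * \<xi>"
    by (simp add: Fsec_eq_rot_section[OF assms(1)] rot_section_def q)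
  note * = lambda_sigma_rot_section[OF g q Fsec_has_derivative[OF assms] F0]
  show "lambda (Fsec \<epsilon> B C) \<xi> =
      \<epsilon> * (profile B C q + q * profile' B C q - 2 * q * profile B C q / (1 + q))"
    unfolding *(1) by (simp add: algebra_simps)
  show "sigma (Fsec \<epsilon> B C) \<xi> = \<i> * of_real (\<epsilon> * profile' B C q) * (cnj \<xi>)\<^sup>2"
    by (rule *(2))
qed

text \<open>Let \<open>g\<close> be the profile.  Then \<open>\<lambda> = g (1-q)/(1+q) + q g'\<close> and \<open>|\<sigma>| = q |g'|\<close> up to signs,
so the difference of squares is \<open>g\<^sup>2 ((1-q)/(1+q))\<^sup>2 + q (g\<^sup>2)' (1-q)/(1+q)\<close>.  Only
\<open>g\<^sup>2 = B/q + C + B q\<close> enters, and the sum collapses because \<open>q (g\<^sup>2)' = - B/q (1 - q) (1 + q)\<close>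
contains the factor \<open>1 - q\<close> a second time.\<close>

lemma lambda_sigma_difference:
  assumes "\<xi> \<noteq> 0" and q: "q = (norm \<xi>)\<^sup>2" and pos: "profile B C q > 0" and e: "\<epsilon>\<^sup>2 = 1"
  shows "(lambda (Fsec \<epsilon> B C) \<xi>)\<^sup>2 - (norm (sigma (Fsec \<epsilon> B C) \<xi>))\<^sup>2 =
    (C - 2 * B) * ((1 - q) / (1 + q))\<^sup>2"
proof -
  have q0: "q > 0" using assms(1) q by simp
  define a where "a = profile B C q"
  define b where "b = profile' B C q"
  have a2: "a\<^sup>2 = B / q + C + B * q" unfolding a_def by (rule profile_squared[OF pos])
  have ab: "2 * a * b = B * (1 - 1 / q\<^sup>2)" using pos by (simp add: a_def b_def profile'_def)
  have "\<bar>\<epsilon>\<bar> = 1" using e by (simp add: power2_eq_1_iff) auto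
  then have "norm (sigma (Fsec \<epsilon> B C) \<xi>) = \<bar>b\<bar> * q"
    unfolding lambda_sigma_Fsec[OF assms(1-3)] by (simp add: norm_mult norm_power q b_def)
  then have s: "(norm (sigma (Fsec \<epsilon> B C) \<xi>))\<^sup>2 = (q * b)\<^sup>2"
    by (simp add: power_mult_distrib mult.commute)
  have l: "a + q * b - 2 * q * a / (1 + q) = a * ((1 - q) / (1 + q)) + q * b"
    using q0 by (simp add: field_simps)
  have "(lambda (Fsec \<epsilon> B C) \<xi>)\<^sup>2 = (a * ((1 - q) / (1 + q)) + q * b)\<^sup>2"
    unfolding lambda_sigma_Fsec[OF assms(1-3)] a_def[symmetric] b_def[symmetric]
      power_mult_distrib e l by simp
  then have "(lambda (Fsec \<epsilon> B C) \<xi>)\<^sup>2 - (norm (sigma (Fsec \<epsilon> B C) \<xi>))\<^sup>2 =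
      a\<^sup>2 * ((1 - q) / (1 + q))\<^sup>2 + q * (2 * a * b) * ((1 - q) / (1 + q))"
    unfolding s by algebra
  also have "\<dots> = (C - 2 * B) * ((1 - q) / (1 + q))\<^sup>2"
  proof -
    have s1: "(1 + q)\<^sup>2 * ((1 - q) / (1 + q)) = 1 - q\<^sup>2"
    proof -
      have "(1 + q) * ((1 - q) / (1 + q)) = 1 - q" using q0 by simp
      then have "(1 + q)\<^sup>2 * ((1 - q) / (1 + q)) = (1 + q) * (1 - q)"
        by (simp only: power2_eq_square mult.assoc)
      then show ?thesis by algebra
    qed
    have "q * (B * (1 - 1 / q\<^sup>2)) = - (B / q * ((1 + q)\<^sup>2 * ((1 - q) / (1 + q))))"
      unfolding s1 using q0 by (simp add: field_simps power2_eq_square)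
    then have "a\<^sup>2 * ((1 - q) / (1 + q))\<^sup>2 + q * (2 * a * b) * ((1 - q) / (1 + q)) =
        (B / q + C + B * q - B / q * (1 + q)\<^sup>2) * ((1 - q) / (1 + q))\<^sup>2"
      unfolding ab a2 by algebra
    also have "B / q + C + B * q - B / q * (1 + q)\<^sup>2 = C - 2 * B"
      using q0 by (simp add: field_simps power2_eq_square)
    finally show ?thesis .
  qed
  finally show ?thesis .
qed

lemma induced_det_Fsec:
  assumes "\<xi> \<noteq> 0" and q: "q = (norm \<xi>)\<^sup>2" and pos: "profile B C q > 0" and e: "\<epsilon>\<^sup>2 = 1"
  shows "induced_det (Fsec \<epsilon> B C) \<xi> = 4 * ((C - 2 * B) * ((1 - q) / (1 + q))\<^sup>2) * (conf \<xi>)\<^sup>2"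
  using induced_det_eq[OF differentiableI[OF Fsec_has_derivative[OF assms(1-3)]], of \<epsilon>]
  unfolding lambda_sigma_difference[OF assms] .

text \<open>In the limiting case the section along a ray through \<open>\<xi>\<close> is a constant multiple of
\<open>|1 - t\<^sup>2|\<close>, which has a corner at \<open>t = 1\<close>.\<close>

lemma Fsec_not_differentiable:
  assumes B: "B > 0" and xi: "norm \<xi> = 1" and e: "\<epsilon> \<in> {1, -1}"
  shows "\<not> Fsec \<epsilon> B (- 2 * B) differentiable (at \<xi>)"
proof
  assume "Fsec \<epsilon> B (- 2 * B) differentiable (at \<xi>)"
  then obtain D where D: "(Fsec \<epsilon> B (- 2 * B) has_derivative D) (at \<xi>)"
    by (auto simp: differentiable_def)
  define F where "F t = Fsec \<epsilon> B (- 2 * B) (of_real t * \<xi>)" for t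
  define k where "k = 1 / (of_real (\<epsilon> * sqrt B) * \<i> * \<xi>)"
  have xi0: "\<xi> \<noteq> 0" using xi by auto
  have lin: "((\<lambda>t. of_real t * \<xi>) has_derivative (\<lambda>h. of_real h * \<xi>)) (at (1::real))"
    by (auto intro!: derivative_eq_intros has_derivative_of_real)
  have "((\<lambda>t. Fsec \<epsilon> B (- 2 * B) (of_real t * \<xi>)) has_derivative (\<lambda>h. D (of_real h * \<xi>))) (at (1::real))"
    using has_derivative_compose[OF lin, of "Fsec \<epsilon> B (- 2 * B)" D] D by simp
  then have "((\<lambda>t. Re (k * F t)) has_derivative (\<lambda>h. Re (k * D (of_real h * \<xi>)))) (at (1::real))"
    unfolding F_def by (intro has_derivative_Re has_derivative_mult_right)
  then have "(\<lambda>t. Re (k * F t)) differentiable (at 1)" by (rule differentiableI)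
  moreover have "Re (k * F t) = \<bar>1 - t\<^sup>2\<bar>" if "t > 0" for t
  proof -
    have n: "norm (of_real t * \<xi>) = t" using that xi by (simp add: norm_mult)
    have "B + - 2 * B * t\<^sup>2 + B * t^4 = B * (1 - t\<^sup>2)\<^sup>2"
      by (simp add: power2_eq_square power4_eq_xxxx algebra_simps)
    then have "F t = of_real \<epsilon> * \<i> * of_real (sqrt B * \<bar>1 - t\<^sup>2\<bar>) * \<xi>"
      unfolding F_def Fsec_def n sgn_eq using that by (simp add: real_sqrt_mult)
    then have "k * F t = of_real \<bar>1 - t\<^sup>2\<bar>"
      using e B xi0 by (auto simp: k_def field_simps)
    then show ?thesis by simp
  qed
  ultimately have "(\<lambda>t::real. \<bar>1 - t\<^sup>2\<bar>) differentiable (at 1)"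
    unfolding differentiable_def
    by (metis (mono_tags, lifting) has_derivative_transform_within_open greaterThan_iff
        open_greaterThan zero_less_one)
  then obtain d where d: "((\<lambda>t::real. \<bar>1 - t\<^sup>2\<bar>) has_real_derivative d) (at 1)"
    using real_differentiable_def by blast
  \<comment> \<open>Both \<open>|1 - t\<^sup>2| - (t\<^sup>2 - 1)\<close> and \<open>|1 - t\<^sup>2| + (t\<^sup>2 - 1)\<close> are nonnegative and vanish at \<open>1\<close>.\<close>
  have "d - 2 = 0"
    by (rule DERIV_local_min[where f = "\<lambda>t. \<bar>1 - t\<^sup>2\<bar> - (t\<^sup>2 - 1)" and x = 1 and d = 1])
      (auto intro!: derivative_eq_intros d)
  moreover have "d + 2 = 0"
    by (rule DERIV_local_min[where f = "\<lambda>t. \<bar>1 - t\<^sup>2\<bar> + (t\<^sup>2 - 1)" and x = 1 and d = 1])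
      (auto intro!: derivative_eq_intros d)
  ultimately show False by simp
qed

text \<open>On the unit circle the determinant vanishes if \<open>C > -2B\<close>, and the section is not
differentiable if \<open>C = -2B\<close>; either way the circle is excluded.\<close>

lemma nondegenerate_locus_Fsec:
  assumes B: "B \<ge> 0" "- 2 * B \<le> C" and ne: "C \<noteq> 2 * B" and e: "\<epsilon> \<in> {1, -1}"
  shows "nondegenerate_locus (- {0}) (Fsec \<epsilon> B C) = {\<xi>. \<xi> \<noteq> 0 \<and> norm \<xi> \<noteq> 1}"
proof -
  have BC: "B > 0 \<or> C > 0" using B ne by auto
  have e2: "\<epsilon>\<^sup>2 = 1" using e by auto
  have "\<xi> \<in> nondegenerate_locus (- {0}) (Fsec \<epsilon> B C)" if xi: "\<xi> \<noteq> 0" "norm \<xi> \<noteq> 1" for \<xi>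
  proof -
    define q where "q = (norm \<xi>)\<^sup>2"
    have q: "q > 0" "q \<noteq> 1"
      using norm_squared_off_circle[OF xi] by (simp_all add: q_def)
    have pos: "profile B C q > 0" using profile_pos[OF B q(1) _ BC] q(2) by simp
    have "induced_det (Fsec \<epsilon> B C) \<xi> \<noteq> 0"
      unfolding induced_det_Fsec[OF xi(1) q_def pos e2] using ne q conf_pos[of \<xi>] by auto
    then show ?thesis
      using xi differentiableI[OF Fsec_has_derivative[OF xi(1) q_def pos]]
      by (simp add: nondegenerate_locus_def)
  qed
  moreover have "norm \<xi> \<noteq> 1" if "\<xi> \<in> nondegenerate_locus (- {0}) (Fsec \<epsilon> B C)" for \<xi>
  proof
    assume xi: "norm \<xi> = 1"
    then have xi0: "\<xi> \<noteq> 0" by auto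
    show False
    proof (cases "- 2 * B < C")
      case True
      then have pos: "profile B C 1 > 0" using profile_pos[OF B _ _ BC, of 1] by simp
      have "induced_det (Fsec \<epsilon> B C) \<xi> = 0"
        using induced_det_Fsec[OF xi0 _ pos e2] xi by simp
      then show False using that by (simp add: nondegenerate_locus_def)
    next
      case False
      then have "C = - 2 * B" "B > 0" using B BC by auto
      then show False
        using Fsec_not_differentiable[OF _ xi e] that by (auto simp: nondegenerate_locus_def)
    qed
  qed
  ultimately show ?thesis by (auto simp: nondegenerate_locus_def)
qed

section \<open>The surfaces are neither holomorphic nor lagrangian\<close>

text \<open>A tangent plane invariant under the complex structure would make the derivative at \<open>\<xi> = 2\<close>
complex linear, that is, \<open>g'(4) = 0\<close>.\<close>

lemma Fsec_not_holomorphic: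
  assumes B: "B > 0" "- 2 * B \<le> C" and e: "\<epsilon> \<in> {1, -1}"
  shows "\<not> holomorphic_graph (- {0}) (Fsec \<epsilon> B C)"
proof
  assume hol: "holomorphic_graph (- {0}) (Fsec \<epsilon> B C)"
  have pos: "profile B C 4 > 0" using profile_pos[of B C 4] B by simp
  have q: "4 = (norm (2::complex))\<^sup>2" by simp
  have two: "(2::complex) \<noteq> 0" by simp
  note D = Fsec_has_derivative[OF two q pos, of \<epsilon>]
  define a where "a = profile B C 4"
  define b where "b = profile' B C 4"
  have b: "b \<noteq> 0" using B(1) pos by (simp add: b_def profile'_def)
  have D': "frechet_derivative (Fsec \<epsilon> B C) (at 2) v =
      \<i> * (of_real (\<epsilon> * a) * v + of_real (\<epsilon> * b * (2 * inner 2 v)) * 2)" for v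
    by (simp only: frechet_derivative_at[OF D, symmetric] a_def b_def)
  have "JJ 2 (Fsec \<epsilon> B C 2) ` graph_tangent (Fsec \<epsilon> B C) 2 \<subseteq> graph_tangent (Fsec \<epsilon> B C) 2"
    using hol differentiableI[OF D] by (simp add: holomorphic_graph_def)
  then have "JJ 2 (Fsec \<epsilon> B C 2) (1, frechet_derivative (Fsec \<epsilon> B C) (at 2) 1) \<in> graph_tangent (Fsec \<epsilon> B C) 2"
    unfolding graph_tangent_def by blast
  then have "\<i> * frechet_derivative (Fsec \<epsilon> B C) (at 2) 1 = frechet_derivative (Fsec \<epsilon> B C) (at 2) \<i>"
    by (auto simp: JJ_coordinates graph_tangent_def)
  then show False
    using b e by (auto simp: D' complex_eq_iff inner_complex_def)
qed

text \<open>The form \<open>\<Omega>\<close> evaluated on the two coordinate tangent vectors is \<open>4 \<lambda>\<close> times the conformal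
factor.\<close>

lemma lagrangian_Fsec_imp_lambda_zero:
  fixes x :: real
  assumes x: "x > 0" and q: "q = x\<^sup>2" and pos: "profile B C q > 0"
    and lag: "lagrangian_graph (- {0}) (Fsec \<epsilon> B C)" and e: "\<epsilon> \<in> {1, -1}"
  shows "profile B C q + q * profile' B C q - 2 * q * profile B C q / (1 + q) = 0"
proof -
  let ?F = "Fsec \<epsilon> B C" and ?x = "complex_of_real x"
  define a where "a = profile B C q"
  define b where "b = profile' B C q"
  have x0: "?x \<noteq> 0" and qx: "q = (norm ?x)\<^sup>2" using x q by auto
  note D = Fsec_has_derivative[OF x0 qx pos, of \<epsilon>]
  have D': "frechet_derivative ?F (at ?x) =
      (\<lambda>v. \<i> * (of_real (\<epsilon> * a) * v + of_real (\<epsilon> * b * (2 * inner ?x v)) * ?x))"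
    using frechet_derivative_at[OF D] by (simp add: a_def b_def)
  have F0: "?F ?x = \<i> * of_real (\<epsilon> * a) * ?x"
    by (simp add: Fsec_eq_rot_section[OF x0] rot_section_def qx a_def)
  have "Omega ?x (?F ?x) (1, frechet_derivative ?F (at ?x) 1) (\<i>, frechet_derivative ?F (at ?x) \<i>) = 0"
    using lag differentiableI[OF D] x0 unfolding lagrangian_graph_def graph_tangent_def by blast
  moreover have "dconf ?x = of_real (conf ?x) * - of_real (2 * x / (1 + q))"
  proof -
    have "dconf ?x = of_real (conf ?x) * christoffel ?x"
      using conf_pos[of ?x] by (simp add: christoffel_def)
    then show ?thesis by (simp add: christoffel_eq q)
  qed
  ultimately have "4 * conf ?x * \<epsilon> * (a + q * b - 2 * q * a / (1 + q)) = 0"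
    by (simp add: Omega_def D' F0 inner_complex_def q power2_eq_square algebra_simps)
  then show ?thesis
    using conf_pos[of ?x] e by (auto simp: a_def b_def)
qed

text \<open>The function \<open>\<lambda>\<close> can vanish on a circle when \<open>C < 0\<close>, so one point does not suffice.  Its
vanishing on the circles of radius \<open>2\<close> and \<open>3\<close> gives two independent linear equations in \<open>B\<close> and
\<open>C\<close>.\<close>

lemma Fsec_not_lagrangian:
  assumes B: "B \<ge> 0" "- 2 * B \<le> C" and ne: "C \<noteq> 2 * B" and e: "\<epsilon> \<in> {1, -1}"
  shows "\<not> lagrangian_graph (- {0}) (Fsec \<epsilon> B C)"
proof
  assume lag: "lagrangian_graph (- {0}) (Fsec \<epsilon> B C)"
  have BC: "B > 0 \<or> C > 0" using B ne by auto
  have *: "B / q + B * q + 2 * C - 2 * B = 0" if x: "x > 1" and q: "q = x\<^sup>2" for x q :: real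
  proof -
    have q1: "q > 1" using x by (simp add: q one_less_power)
    have pos: "profile B C q > 0" using profile_pos[OF B _ _ BC, of q] q1 by simp
    define a where "a = profile B C q"
    define b where "b = profile' B C q"
    have a2: "a\<^sup>2 = B / q + C + B * q" unfolding a_def by (rule profile_squared[OF pos])
    have ab: "2 * a * b = B * (1 - 1 / q\<^sup>2)" using pos by (simp add: a_def b_def profile'_def)
    have "a + q * b - 2 * q * a / (1 + q) = 0"
      unfolding a_def b_def using lagrangian_Fsec_imp_lambda_zero[OF _ q pos lag e] x by simp
    then have "2 * a * (1 + q) * (a + q * b - 2 * q * a / (1 + q)) = 0" by simp
    moreover have "2 * a * (1 + q) * (a + q * b - 2 * q * a / (1 + q)) =
        2 * a\<^sup>2 * (1 - q) + q * (1 + q) * (2 * a * b)"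
      using q1 by (simp add: field_simps power2_eq_square)
    moreover have "\<dots> = (1 - q) * (B / q + B * q + 2 * C - 2 * B)"
      unfolding a2 ab using q1 by (simp add: field_simps power2_eq_square)
    ultimately show ?thesis using q1 by simp
  qed
  have "B / 4 + B * 4 + 2 * C - 2 * B = 0" using *[of 2 4] by simp
  moreover have "B / 9 + B * 9 + 2 * C - 2 * B = 0" using *[of 3 9] by simp
  ultimately have "B = 0" "C = 0" by simp_all
  then show False using ne by simp
qed

section \<open>The first variation as a divergence\<close>

lemma lambda_sigma_add:
  assumes "F differentiable (at \<xi>)" "\<phi> differentiable (at \<xi>)"
  shows "(\<lambda>z. F z + t *\<^sub>R \<phi> z) differentiable (at \<xi>)"
    and "lambda (\<lambda>z. F z + t *\<^sub>R \<phi> z) \<xi> = lambda F \<xi> + t * lambda \<phi> \<xi>"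
    and "sigma (\<lambda>z. F z + t *\<^sub>R \<phi> z) \<xi> = sigma F \<xi> + of_real t * sigma \<phi> \<xi>"
proof -
  let ?F = "\<lambda>z. F z + t *\<^sub>R \<phi> z"
  have D: "(?F has_derivative
      (\<lambda>v. frechet_derivative F (at \<xi>) v + t *\<^sub>R frechet_derivative \<phi> (at \<xi>) v)) (at \<xi>)"
    using assms unfolding frechet_derivative_works
    by (intro has_derivative_add has_derivative_scaleR_right)
  then show diff: "?F differentiable (at \<xi>)" by (rule differentiableI)
  have D': "frechet_derivative ?F (at \<xi>) =
      (\<lambda>v. frechet_derivative F (at \<xi>) v + t *\<^sub>R frechet_derivative \<phi> (at \<xi>) v)"
    using D by (rule frechet_derivative_at[symmetric])
  have "rho ?F \<xi> = rho F \<xi> + of_real t * rho \<phi> \<xi>"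
    unfolding rho_alt[OF diff] rho_alt[OF assms(1)] rho_alt[OF assms(2)]
      wirt_def D'
    by (simp add: scaleR_conv_of_real field_simps)
  then show "lambda ?F \<xi> = lambda F \<xi> + t * lambda \<phi> \<xi>"
    by (simp add: lambda_def)
  show "sigma ?F \<xi> = sigma F \<xi> + of_real t * sigma \<phi> \<xi>"
    unfolding sigma_alt[OF diff] sigma_alt[OF assms(1)] sigma_alt[OF assms(2)]
      wirt_bar_def D'
    by (simp add: scaleR_conv_of_real field_simps)
qed

text \<open>The functions \<open>\<lambda>\<close> and \<open>\<sigma>\<close> depend linearly on the section, so the determinant is a
quadratic polynomial in the parameter of the variation.\<close>

lemma induced_det_add:
  assumes "F differentiable (at \<xi>)" "\<phi> differentiable (at \<xi>)"
  shows "induced_det (\<lambda>z. F z + t *\<^sub>R \<phi> z) \<xi> =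
    4 * ((lambda F \<xi>)\<^sup>2 - (norm (sigma F \<xi>))\<^sup>2) * (conf \<xi>)\<^sup>2
    + 8 * (lambda F \<xi> * lambda \<phi> \<xi> - Re (sigma F \<xi> * cnj (sigma \<phi> \<xi>))) * (conf \<xi>)\<^sup>2 * t
    + 4 * ((lambda \<phi> \<xi>)\<^sup>2 - (norm (sigma \<phi> \<xi>))\<^sup>2) * (conf \<xi>)\<^sup>2 * t\<^sup>2"
  unfolding induced_det_eq[OF lambda_sigma_add(1)[OF assms]] lambda_sigma_add(2,3)[OF assms]
    cmod_power2
  by (simp add: power2_eq_square algebra_simps)

definition radial_sign :: "real \<Rightarrow> real"
  where "radial_sign q = sgn (1 - q)"

text \<open>The two weights are the coefficients of \<open>\<sigma>\<close> and \<open>\<lambda>\<close> divided by \<open>(1 + q) |1 - q|\<close>, see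
\<open>weights_eq\<close>; this denominator comes from the conformal factor and from the root of the
determinant.  In the closed forms used here the factor \<open>1 - q\<close> has cancelled except for its
sign.\<close>

definition shear_weight :: "real \<Rightarrow> real \<Rightarrow> real \<Rightarrow> real"
  where "shear_weight B C q = - radial_sign q * B / (2 * q\<^sup>2 * profile B C q)"

definition twist_weight :: "real \<Rightarrow> real \<Rightarrow> real \<Rightarrow> real"
  where "twist_weight B C q =
    radial_sign q * (profile B C q / (1 + q)\<^sup>2 - B / (2 * q * profile B C q))"

definition shear_weight' :: "real \<Rightarrow> real \<Rightarrow> real \<Rightarrow> real"
  where "shear_weight' B C q = radial_sign q * B / 2 *
    (2 / (q^3 * profile B C q) + profile' B C q / (q\<^sup>2 * (profile B C q)\<^sup>2))"

definition twist_weight' :: "real \<Rightarrow> real \<Rightarrow> real \<Rightarrow> real"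
  where "twist_weight' B C q = radial_sign q *
    (profile' B C q / (1 + q)\<^sup>2 - 2 * profile B C q / (1 + q)^3
      + B / 2 * (1 / (q\<^sup>2 * profile B C q) + profile' B C q / (q * (profile B C q)\<^sup>2)))"

lemma radial_sign_deriv:
  assumes "q \<noteq> 1"
  shows "(radial_sign has_real_derivative 0) (at q)"
proof -
  have "((\<lambda>_. radial_sign q) has_real_derivative 0) (at q)" by simp
  then show ?thesis
  proof (rule has_field_derivative_transform_within_open)
    show "open (if q < 1 then {..<1} else {1<..} :: real set)" by simp
  qed (use assms in \<open>auto simp: radial_sign_def split: if_splits\<close>)
qed

lemma weight_derivs:
  assumes q: "q > 0" "q \<noteq> 1" and pos: "profile B C q > 0"
  shows "(shear_weight B C has_real_derivative shear_weight' B C q) (at q)"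
    and "(twist_weight B C has_real_derivative twist_weight' B C q) (at q)"
proof -
  note d = radial_sign_deriv[OF q(2)] profile_deriv[OF q(1) pos]
  show "(shear_weight B C has_real_derivative shear_weight' B C q) (at q)"
    unfolding shear_weight_def[abs_def] shear_weight'_def
    using q pos
    by (auto intro!: derivative_eq_intros d)
       (simp add: field_simps power2_eq_square power3_eq_cube power4_eq_xxxx)
  have p: "1 + q > 0" using q by simp
  have e1: "(b * p\<^sup>2 - a * (2 * p)) / (p\<^sup>2 * p\<^sup>2) = b / p\<^sup>2 - 2 * a / p^3" if "p > 0" for a b p :: real
    using that by (simp add: field_simps power2_eq_square power3_eq_cube)
  have e2: "- (B * (2 * a + 2 * q * b)) / ((2 * q * a) * (2 * q * a)) =
      - (B / 2 * (1 / (q\<^sup>2 * a) + b / (q * a\<^sup>2)))" if "a > 0" for a b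
    using that q by (simp add: field_simps power2_eq_square)
  have d1: "((\<lambda>q. profile B C q / (1 + q)\<^sup>2) has_real_derivative
      (profile' B C q * (1 + q)\<^sup>2 - profile B C q * (2 * (1 + q))) / ((1 + q)\<^sup>2 * (1 + q)\<^sup>2)) (at q)"
    using p by (auto intro!: derivative_eq_intros d)
  have d2: "((\<lambda>q. B / (2 * q * profile B C q)) has_real_derivative
      - (B * (2 * profile B C q + 2 * q * profile' B C q)) /
        ((2 * q * profile B C q) * (2 * q * profile B C q))) (at q)"
    using q pos by (auto intro!: derivative_eq_intros d)
  have "((\<lambda>q. radial_sign q * (profile B C q / (1 + q)\<^sup>2 - B / (2 * q * profile B C q)))
      has_real_derivative 0 * (profile B C q / (1 + q)\<^sup>2 - B / (2 * q * profile B C q)) +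
        (profile' B C q / (1 + q)\<^sup>2 - 2 * profile B C q / (1 + q)^3 -
          - (B / 2 * (1 / (q\<^sup>2 * profile B C q) + profile' B C q / (q * (profile B C q)\<^sup>2)))) *
        radial_sign q) (at q)"
    by (intro DERIV_mult d(1) DERIV_diff d1[unfolded e1[OF p]] d2[unfolded e2[OF pos]])
  then show "(twist_weight B C has_real_derivative twist_weight' B C q) (at q)"
    unfolding twist_weight_def[abs_def] twist_weight'_def by (simp add: algebra_simps)
qed

lemma profile'_factored:
  assumes "q > 0" "profile B C q > 0"
  shows "profile' B C q = - (B / (2 * q\<^sup>2 * profile B C q)) * ((1 - q) * (1 + q))"
  using assms by (simp add: profile'_def field_simps power2_eq_square)

text \<open>The Euler-Lagrange equation of the area functional for the sections of the family, after a
common factor \<open>\<xi>\<close>-bar has been divided out.\<close>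

lemma weight_equation:
  assumes q: "q > 0" and pos: "profile B C q > 0"
  shows "q * shear_weight' B C q + 2 * shear_weight B C q - twist_weight' B C q =
    2 * twist_weight B C q / (1 + q)"
proof -
  define s where "s = radial_sign q"
  define a where "a = profile B C q"
  define b where "b = profile' B C q"
  define p where "p = 1 + q"
  have a: "a > 0" using pos by (simp add: a_def)
  have p: "p > 0" using q by (simp add: p_def)
  have b: "b = - (B / (2 * q\<^sup>2 * a)) * ((1 - q) * p)"
    unfolding a_def b_def p_def by (rule profile'_factored[OF q pos])
  have "q * (B / 2 * (2 / (q^3 * a) + b / (q\<^sup>2 * a\<^sup>2))) - B / (q\<^sup>2 * a)
      - (b / p\<^sup>2 - 2 * a / p^3 + B / 2 * (1 / (q\<^sup>2 * a) + b / (q * a\<^sup>2))) =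
      2 * a / p^3 - B / (2 * q\<^sup>2 * a) - b / p\<^sup>2"
    using a q p by (simp add: field_simps power2_eq_square power3_eq_cube)
  also have "B / (2 * q\<^sup>2 * a) + b / p\<^sup>2 = B / (q * a * p)"
  proof -
    have "b / p\<^sup>2 = - (B / (2 * q\<^sup>2 * a)) * ((1 - q) / p)"
      unfolding b using p by (simp add: power2_eq_square)
    then have "B / (2 * q\<^sup>2 * a) + b / p\<^sup>2 = B / (2 * q\<^sup>2 * a) * (1 - (1 - q) / p)"
      by (simp only: right_diff_distrib mult_1_right mult_minus_left add_uminus_conv_diff)
    also have "1 - (1 - q) / p = 2 * q / p" using p by (simp add: p_def field_simps)
    also have "B / (2 * q\<^sup>2 * a) * (2 * q / p) = B / (q * a * p)"
      using q by (simp add: power2_eq_square)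
    finally show ?thesis .
  qed
  then have e2: "2 * a / p^3 - B / (2 * q\<^sup>2 * a) - b / p\<^sup>2 = 2 * a / p^3 - B / (q * a * p)"
    by simp
  also have "\<dots> = 2 * (a / p\<^sup>2 - B / (2 * q * a)) / p"
    using a q p by (simp add: field_simps power2_eq_square power3_eq_cube)
  finally have e: "q * (B / 2 * (2 / (q^3 * a) + b / (q\<^sup>2 * a\<^sup>2))) - B / (q\<^sup>2 * a)
      - (b / p\<^sup>2 - 2 * a / p^3 + B / 2 * (1 / (q\<^sup>2 * a) + b / (q * a\<^sup>2))) =
      2 * (a / p\<^sup>2 - B / (2 * q * a)) / p" .
  have "q * shear_weight' B C q + 2 * shear_weight B C q - twist_weight' B C q =
     s * (q * (B / 2 * (2 / (q^3 * a) + b / (q\<^sup>2 * a\<^sup>2))) - B / (q\<^sup>2 * a)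
      - (b / p\<^sup>2 - 2 * a / p^3 + B / 2 * (1 / (q\<^sup>2 * a) + b / (q * a\<^sup>2))))"
    unfolding shear_weight'_def shear_weight_def twist_weight'_def a_def[symmetric]
      b_def[symmetric] s_def[symmetric] p_def[symmetric]
    using a q by (simp add: algebra_simps)
  also have "\<dots> = 2 * twist_weight B C q / (1 + q)"
    unfolding e twist_weight_def a_def[symmetric] s_def[symmetric] p_def[symmetric] by simp
  finally show ?thesis .
qed

text \<open>The cancellation is due to \<open>g' = - B (1 - q) (1 + q) / (2 q\<^sup>2 g)\<close> for the profile \<open>g\<close>.\<close>

lemma weights_eq:
  assumes q: "q > 0" "q \<noteq> 1" and pos: "profile B C q > 0"
  shows "shear_weight B C q = profile' B C q / ((1 + q) * \<bar>1 - q\<bar>)"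
    and "twist_weight B C q =
      (profile B C q + q * profile' B C q - 2 * q * profile B C q / (1 + q)) / ((1 + q) * \<bar>1 - q\<bar>)"
proof -
  define s where "s = radial_sign q"
  define a where "a = profile B C q"
  define b where "b = profile' B C q"
  define r where "r = 1 - q"
  define p where "p = 1 + q"
  have a: "a > 0" using pos by (simp add: a_def)
  have p: "p > 0" using q by (simp add: p_def)
  have r: "r \<noteq> 0" using q by (simp add: r_def)
  have b: "b = - (B / (2 * q\<^sup>2 * a)) * (r * p)"
    unfolding a_def b_def p_def r_def by (rule profile'_factored[OF q(1) pos])
  have s: "r / \<bar>r\<bar> = s" 
    using r by (auto simp: s_def radial_sign_def r_def[symmetric] sgn_real_def abs_if)
  have "b / (p * \<bar>r\<bar>) = - (B / (2 * q\<^sup>2 * a)) * (r / \<bar>r\<bar>)"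
    unfolding b using p by (simp add: field_simps)
  then have 1: "b / (p * \<bar>r\<bar>) = - s * B / (2 * q\<^sup>2 * a)"
    unfolding s by simp
  then show "shear_weight B C q = profile' B C q / ((1 + q) * \<bar>1 - q\<bar>)"
    by (simp add: shear_weight_def a_def b_def s_def p_def r_def)
  have l: "a + q * b - 2 * q * a / p = a * (r / p) + q * b"
    using p by (simp add: p_def r_def field_simps)
  have "(a + q * b - 2 * q * a / p) / (p * \<bar>r\<bar>) = a / p\<^sup>2 * (r / \<bar>r\<bar>) + q * (b / (p * \<bar>r\<bar>))"
    unfolding l using p by (simp add: add_divide_distrib power2_eq_square)
  also have "\<dots> = s * (a / p\<^sup>2 - B / (2 * q * a))"
    unfolding s 1 using q by (simp add: power2_eq_square algebra_simps)
  finally show "twist_weight B C q =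
      (profile B C q + q * profile' B C q - 2 * q * profile B C q / (1 + q)) / ((1 + q) * \<bar>1 - q\<bar>)"
    by (simp add: twist_weight_def a_def b_def s_def p_def r_def)
qed

text \<open>Let \<open>H\<close> and \<open>m\<close> be the shear and the twist weight, and \<open>w = 1 / ((1 + q) |1 - q|)\<close>.  The
linearised area density is, up to a constant, the real part of
\<open>\<sigma> w \<partial>\<close>-bar\<open> \<phi> - \<i> \<lambda> w (\<partial> \<phi> + \<Gamma> \<phi>)\<close> where, for \<open>\<epsilon> = 1\<close>, \<open>\<sigma> w = \<i> H \<xi>\<close>-bar\<open>\<^sup>2\<close> and \<open>\<lambda> w = m\<close>, and
\<open>\<Gamma>\<close> is the Christoffel symbol.  By \<open>weight_equation\<close> it equals the real part of
\<open>\<partial>\<close>-bar\<open> (\<sigma> w \<phi>) - \<i> \<partial> (\<lambda> w \<phi>)\<close>; expanding the Wirtinger derivatives into \<open>\<partial>/\<partial>x\<close> and \<open>\<partial>/\<partial>y\<close>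
exhibits twice this expression as the divergence of the real vector field with components
\<open>flux1\<close> and \<open>flux2\<close>.\<close>

definition flux1 :: "real \<Rightarrow> real \<Rightarrow> (complex \<Rightarrow> complex) \<Rightarrow> complex \<Rightarrow> real"
  where "flux1 B C \<phi> z = - Im ((of_real (shear_weight B C ((norm z)\<^sup>2)) * (cnj z)\<^sup>2
    - of_real (twist_weight B C ((norm z)\<^sup>2))) * \<phi> z)"

definition flux2 :: "real \<Rightarrow> real \<Rightarrow> (complex \<Rightarrow> complex) \<Rightarrow> complex \<Rightarrow> real"
  where "flux2 B C \<phi> z = - Re ((of_real (shear_weight B C ((norm z)\<^sup>2)) * (cnj z)\<^sup>2
    + of_real (twist_weight B C ((norm z)\<^sup>2))) * \<phi> z)"

text \<open>The derivative in direction \<open>v\<close> of the coefficient of \<open>\<phi>\<close> in the flux; \<open>e\<close> is the sign in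
front of the twist weight.\<close>

definition coeff_deriv :: "real \<Rightarrow> real \<Rightarrow> real \<Rightarrow> complex \<Rightarrow> complex \<Rightarrow> complex"
  where "coeff_deriv B C e z v =
    of_real (shear_weight' B C ((norm z)\<^sup>2) * (2 * inner z v)) * (cnj z)\<^sup>2
    + of_real (shear_weight B C ((norm z)\<^sup>2)) * (2 * cnj z * cnj v)
    + of_real (e * (twist_weight' B C ((norm z)\<^sup>2) * (2 * inner z v)))"

lemma flux_has_derivative:
  assumes xi: "\<xi> \<noteq> 0" "norm \<xi> \<noteq> 1" and pos: "profile B C ((norm \<xi>)\<^sup>2) > 0"
    and phi: "(\<phi> has_derivative D) (at \<xi>)"
  shows "(flux1 B C \<phi> has_derivative (\<lambda>v. - Im (coeff_deriv B C (-1) \<xi> v * \<phi> \<xi>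
      + (of_real (shear_weight B C ((norm \<xi>)\<^sup>2)) * (cnj \<xi>)\<^sup>2
        - of_real (twist_weight B C ((norm \<xi>)\<^sup>2))) * D v))) (at \<xi>)"
    and "(flux2 B C \<phi> has_derivative (\<lambda>v. - Re (coeff_deriv B C 1 \<xi> v * \<phi> \<xi>
      + (of_real (shear_weight B C ((norm \<xi>)\<^sup>2)) * (cnj \<xi>)\<^sup>2
        + of_real (twist_weight B C ((norm \<xi>)\<^sup>2))) * D v))) (at \<xi>)"
proof -
  note q = norm_squared_off_circle[OF xi]
  note w = weight_derivs[OF q pos, THEN radial_has_derivative, THEN has_derivative_of_real]
  have sq: "((\<lambda>z. (cnj z)\<^sup>2) has_derivative (\<lambda>v. 2 * cnj \<xi> * cnj v)) (at \<xi>)"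
    by (auto intro!: derivative_eq_intros)
  have c1: "((\<lambda>z. of_real (shear_weight B C ((norm z)\<^sup>2)) * (cnj z)\<^sup>2
      - of_real (twist_weight B C ((norm z)\<^sup>2))) has_derivative coeff_deriv B C (-1) \<xi>) (at \<xi>)"
    by (rule has_derivative_eq_rhs[OF has_derivative_diff[OF has_derivative_mult[OF w(1) sq] w(2)]])
       (simp add: fun_eq_iff coeff_deriv_def)
  have c2: "((\<lambda>z. of_real (shear_weight B C ((norm z)\<^sup>2)) * (cnj z)\<^sup>2
      + of_real (twist_weight B C ((norm z)\<^sup>2))) has_derivative coeff_deriv B C 1 \<xi>) (at \<xi>)"
    by (rule has_derivative_eq_rhs[OF has_derivative_add[OF has_derivative_mult[OF w(1) sq] w(2)]])
       (simp add: fun_eq_iff coeff_deriv_def)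
  show "(flux1 B C \<phi> has_derivative (\<lambda>v. - Im (coeff_deriv B C (-1) \<xi> v * \<phi> \<xi>
      + (of_real (shear_weight B C ((norm \<xi>)\<^sup>2)) * (cnj \<xi>)\<^sup>2
        - of_real (twist_weight B C ((norm \<xi>)\<^sup>2))) * D v))) (at \<xi>)"
    unfolding flux1_def[abs_def]
    by (rule has_derivative_eq_rhs[OF has_derivative_minus[OF has_derivative_Im[OF
            has_derivative_mult[OF c1 phi]]]]) (simp add: fun_eq_iff algebra_simps)
  show "(flux2 B C \<phi> has_derivative (\<lambda>v. - Re (coeff_deriv B C 1 \<xi> v * \<phi> \<xi>
      + (of_real (shear_weight B C ((norm \<xi>)\<^sup>2)) * (cnj \<xi>)\<^sup>2
        + of_real (twist_weight B C ((norm \<xi>)\<^sup>2))) * D v))) (at \<xi>)"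
    unfolding flux2_def[abs_def]
    by (rule has_derivative_eq_rhs[OF has_derivative_minus[OF has_derivative_Re[OF
            has_derivative_mult[OF c2 phi]]]]) (simp add: fun_eq_iff algebra_simps)
qed

text \<open>The terms with derivatives of \<open>\<phi>\<close> match identically.  The terms with \<open>\<phi>\<close> itself combine to
the Christoffel term of \<open>\<lambda>(\<phi>)\<close> by \<open>weight_equation\<close>.\<close>

lemma flux_divergence:
  assumes xi: "\<xi> \<noteq> 0" "norm \<xi> \<noteq> 1" and q: "q = (norm \<xi>)\<^sup>2" and pos: "profile B C q > 0"
    and phi: "(\<phi> has_derivative D) (at \<xi>)"
  shows "frechet_derivative (flux1 B C \<phi>) (at \<xi>) 1 + frechet_derivative (flux2 B C \<phi>) (at \<xi>) \<i> =
    2 * (twist_weight B C q * lambda \<phi> \<xi>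
      - shear_weight B C q * Im ((cnj \<xi>)\<^sup>2 * wirt_bar \<phi> \<xi>))"
proof -
  have q0: "q > 0" using xi q by simp
  define H where "H = shear_weight B C q"
  define m where "m = twist_weight B C q"
  define H' where "H' = shear_weight' B C q"
  define m' where "m' = twist_weight' B C q"
  define x where "x = Re \<xi>"
  define y where "y = Im \<xi>"
  define a where "a = Re (\<phi> \<xi>)"
  define b where "b = Im (\<phi> \<xi>)"
  define k where "k = 2 / (1 + q)"
  have q': "q = x\<^sup>2 + y\<^sup>2" by (simp add: q cmod_power2 x_def y_def)
  have m'eq: "m' = q * H' + 2 * H - k * m"
    using weight_equation[OF q0 pos]
    by (simp add: H_def m_def H'_def m'_def k_def)
  have diff: "\<phi> differentiable (at \<xi>)" using phi by (rule differentiableI)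
  have D: "frechet_derivative \<phi> (at \<xi>) = D" by (rule frechet_derivative_at[OF phi, symmetric])
  note fl = flux_has_derivative[OF xi pos[unfolded q] phi, folded q]
  have lam: "lambda \<phi> \<xi> = (Im (D 1) - Re (D \<i>)) / 2 - k * (x * b - y * a)"
    by (simp add: lambda_def rho_alt[OF diff] wirt_def D christoffel_eq k_def q[symmetric]
        x_def y_def a_def b_def algebra_simps diff_divide_distrib add_divide_distrib)
  have wb: "Im ((cnj \<xi>)\<^sup>2 * wirt_bar \<phi> \<xi>) =
      ((x\<^sup>2 - y\<^sup>2) * (Im (D 1) + Re (D \<i>)) - 2 * x * y * (Re (D 1) - Im (D \<i>))) / 2"
    by (simp add: wirt_bar_def D x_def y_def power2_eq_square algebra_simps)
  have 1: "frechet_derivative (flux1 B C \<phi>) (at \<xi>) 1 =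
      - ((H' * 2 * x * (x\<^sup>2 - y\<^sup>2) + 2 * H * x - m' * 2 * x) * b
         - (H' * 2 * x * (2 * x * y) + 2 * H * y) * a
         + (H * (x\<^sup>2 - y\<^sup>2) - m) * Im (D 1) - H * (2 * x * y) * Re (D 1))"
    unfolding frechet_derivative_at[OF fl(1), symmetric] coeff_deriv_def q[symmetric]
    by (simp add: H_def m_def H'_def m'_def x_def y_def a_def b_def inner_complex_def
        power2_eq_square algebra_simps)
  have 2: "frechet_derivative (flux2 B C \<phi>) (at \<xi>) \<i> =
      - ((H' * 2 * y * (x\<^sup>2 - y\<^sup>2) - 2 * H * y + m' * 2 * y) * a
         + (H' * 2 * y * (2 * x * y) + 2 * H * x) * b
         + (H * (x\<^sup>2 - y\<^sup>2) + m) * Re (D \<i>) + H * (2 * x * y) * Im (D \<i>))"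
    unfolding frechet_derivative_at[OF fl(2), symmetric] coeff_deriv_def q[symmetric]
    by (simp add: H_def m_def H'_def m'_def x_def y_def a_def b_def inner_complex_def
        power2_eq_square algebra_simps)
  show ?thesis
    unfolding 1 2 lam wb H_def[symmetric] m_def[symmetric] m'eq
    unfolding q'
    by (simp add: field_simps power2_eq_square)
qed

lemma profile_pos_off_circle:
  assumes "B \<ge> 0" "- 2 * B \<le> C" "C \<noteq> 2 * B" "q > 0" "q \<noteq> 1"
  shows "profile B C q > 0"
proof -
  have "B > 0 \<or> C > 0" using assms(1-3) by auto
  then show ?thesis using profile_pos[OF assms(1,2,4)] assms(5) by blast
qed

section \<open>Stationarity\<close>

lemma weights_continuous:
  assumes "B \<ge> 0" "- 2 * B \<le> C" "C \<noteq> 2 * B"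
  defines "T \<equiv> {q :: real. q > 0 \<and> q \<noteq> 1}"
  shows "continuous_on T (profile B C)" "continuous_on T (profile' B C)"
    "continuous_on T (shear_weight B C)" "continuous_on T (twist_weight B C)"
    "continuous_on T (shear_weight' B C)" "continuous_on T (twist_weight' B C)"
proof -
  have pos: "profile B C q > 0" if "q \<in> T" for q
    using profile_pos_off_circle[OF assms(1-3)] that by (simp add: T_def)
  have nz: "profile B C q \<noteq> 0" "q \<noteq> 0" "1 + q \<noteq> 0" if "q \<in> T" for q
    using pos[OF that] that by (auto simp: T_def)
  have s: "continuous_on T radial_sign"
    using DERIV_isCont[OF radial_sign_deriv]
    by (intro continuous_at_imp_continuous_on) (auto simp: T_def)
  show a: "continuous_on T (profile B C)"
    unfolding profile_def[abs_def] by (intro continuous_intros) (use nz in auto)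
  show b: "continuous_on T (profile' B C)"
    unfolding profile'_def[abs_def] by (intro continuous_intros a) (use nz in auto)
  show "continuous_on T (shear_weight B C)"
    unfolding shear_weight_def[abs_def] by (intro continuous_intros a s) (use nz in auto)
  show "continuous_on T (twist_weight B C)"
    unfolding twist_weight_def[abs_def] by (intro continuous_intros a s) (use nz in auto)
  show "continuous_on T (shear_weight' B C)"
    unfolding shear_weight'_def[abs_def] by (intro continuous_intros a b s) (use nz in auto)
  show "continuous_on T (twist_weight' B C)"
    unfolding twist_weight'_def[abs_def] by (intro continuous_intros a b s) (use nz in auto)
qed

lemma continuous_on_radial:
  assumes "continuous_on {q :: real. q > 0 \<and> q \<noteq> 1} f"
  shows "continuous_on {\<xi> :: complex. \<xi> \<noteq> 0 \<and> norm \<xi> \<noteq> 1} (\<lambda>\<xi>. f ((norm \<xi>)\<^sup>2))"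
proof (rule continuous_on_compose2[OF assms])
  show "continuous_on {\<xi> :: complex. \<xi> \<noteq> 0 \<and> norm \<xi> \<noteq> 1} (\<lambda>\<xi>. (norm \<xi>)\<^sup>2)"
    by (intro continuous_intros)
  show "(\<lambda>\<xi>. (norm \<xi>)\<^sup>2) ` {\<xi> :: complex. \<xi> \<noteq> 0 \<and> norm \<xi> \<noteq> 1} \<subseteq> {q. q > 0 \<and> q \<noteq> 1}"
    by (rule image_subsetI) (use norm_squared_off_circle in blast)
qed

lemma lambda_sigma_continuous_of_C1:
  assumes "\<And>z. \<phi> differentiable (at z)"
    and "\<And>v. continuous_on UNIV (\<lambda>z. frechet_derivative \<phi> (at z) v)"
  shows "continuous_on S (lambda \<phi>)" "continuous_on S (sigma \<phi>)"
proof -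
  have phi: "continuous_on S \<phi>"
    using assms(1) by (meson continuous_at_imp_continuous_on differentiable_imp_continuous_within)
  have d: "continuous_on S (\<lambda>z. frechet_derivative \<phi> (at z) v)" for v
    using assms(2) continuous_on_subset by blast
  have ch: "continuous_on S christoffel"
    unfolding christoffel_eq[abs_def]
    by (intro continuous_intros) (metis one_plus_pos(1) less_irrefl)
  show "continuous_on S (lambda \<phi>)"
    unfolding lambda_def[abs_def] rho_alt[OF assms(1)] wirt_def
    by (intro continuous_intros phi d ch) auto
  show "continuous_on S (sigma \<phi>)"
    by (subst sigma_alt[OF assms(1), abs_def], subst wirt_bar_def[abs_def])
       (intro continuous_intros d, auto)
qed

lemma flux_integral_zero:
  assumes B: "B \<ge> 0" "- 2 * B \<le> C" "C \<noteq> 2 * B"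
  defines "U \<equiv> {\<xi> :: complex. \<xi> \<noteq> 0 \<and> norm \<xi> \<noteq> 1}"
  assumes K: "compact K" "K \<subseteq> U"
    and diff: "\<And>z. \<phi> differentiable (at z)"
    and dcont: "\<And>v. continuous_on UNIV (\<lambda>z. frechet_derivative \<phi> (at z) v)"
    and zero: "\<forall>\<xi>. \<xi> \<notin> K \<longrightarrow> \<phi> \<xi> = 0"
  shows "set_integrable lborel K (\<lambda>\<xi>. frechet_derivative (flux1 B C \<phi>) (at \<xi>) 1)"
    and "set_integrable lborel K (\<lambda>\<xi>. frechet_derivative (flux2 B C \<phi>) (at \<xi>) \<i>)"
    and "(LINT \<xi>:K|lborel. frechet_derivative (flux1 B C \<phi>) (at \<xi>) 1) = 0"
    and "(LINT \<xi>:K|lborel. frechet_derivative (flux2 B C \<phi>) (at \<xi>) \<i>) = 0"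
proof -
  have "U = - {0} \<inter> (- sphere 0 1)" by (auto simp: U_def)
  then have U: "open U"
    by (simp only:) (intro open_Int open_Compl closed_singleton closed_sphere)
  have phi: "(\<phi> has_derivative frechet_derivative \<phi> (at z)) (at z)" for z
    using diff by (simp add: frechet_derivative_works)
  have phic: "continuous_on U \<phi>"
    using diff by (meson continuous_at_imp_continuous_on differentiable_imp_continuous_within)
  have dc: "continuous_on U (\<lambda>z. frechet_derivative \<phi> (at z) v)" for v
    using dcont continuous_on_subset by blast
  have fl: "(flux1 B C \<phi> has_derivative (\<lambda>v. - Im (coeff_deriv B C (-1) \<xi> v * \<phi> \<xi>
      + (of_real (shear_weight B C ((norm \<xi>)\<^sup>2)) * (cnj \<xi>)\<^sup>2
        - of_real (twist_weight B C ((norm \<xi>)\<^sup>2))) * frechet_derivative \<phi> (at \<xi>) v))) (at \<xi>)"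
    "(flux2 B C \<phi> has_derivative (\<lambda>v. - Re (coeff_deriv B C 1 \<xi> v * \<phi> \<xi>
      + (of_real (shear_weight B C ((norm \<xi>)\<^sup>2)) * (cnj \<xi>)\<^sup>2
        + of_real (twist_weight B C ((norm \<xi>)\<^sup>2))) * frechet_derivative \<phi> (at \<xi>) v))) (at \<xi>)"
    if "\<xi> \<in> U" for \<xi>
  proof -
    have xi: "\<xi> \<noteq> 0" "norm \<xi> \<noteq> 1" using that by (auto simp: U_def)
    have pos: "profile B C ((norm \<xi>)\<^sup>2) > 0"
      by (rule profile_pos_off_circle[OF B norm_squared_off_circle[OF xi]])
    show "(flux1 B C \<phi> has_derivative (\<lambda>v. - Im (coeff_deriv B C (-1) \<xi> v * \<phi> \<xi>
      + (of_real (shear_weight B C ((norm \<xi>)\<^sup>2)) * (cnj \<xi>)\<^sup>2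
        - of_real (twist_weight B C ((norm \<xi>)\<^sup>2))) * frechet_derivative \<phi> (at \<xi>) v))) (at \<xi>)"
      "(flux2 B C \<phi> has_derivative (\<lambda>v. - Re (coeff_deriv B C 1 \<xi> v * \<phi> \<xi>
      + (of_real (shear_weight B C ((norm \<xi>)\<^sup>2)) * (cnj \<xi>)\<^sup>2
        + of_real (twist_weight B C ((norm \<xi>)\<^sup>2))) * frechet_derivative \<phi> (at \<xi>) v))) (at \<xi>)"
      by (rule flux_has_derivative[OF xi pos phi])+
  qed
  note w = weights_continuous[OF B, THEN continuous_on_radial, folded U_def]
  have cd: "continuous_on U (\<lambda>\<xi>. coeff_deriv B C e \<xi> v)" for e v
    unfolding coeff_deriv_def by (intro continuous_intros w)
  have D: "(flux1 B C \<phi> has_derivative frechet_derivative (flux1 B C \<phi>) (at \<xi>)) (at \<xi>)"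
    "(flux2 B C \<phi> has_derivative frechet_derivative (flux2 B C \<phi>) (at \<xi>)) (at \<xi>)"
    if "\<xi> \<in> U" for \<xi>
    using fl[OF that, THEN differentiableI] by (simp_all add: frechet_derivative_works)
  have c: "continuous_on U (\<lambda>\<xi>. frechet_derivative (flux1 B C \<phi>) (at \<xi>) v)"
    "continuous_on U (\<lambda>\<xi>. frechet_derivative (flux2 B C \<phi>) (at \<xi>) v)" for v
    by (simp_all add: frechet_derivative_at[OF fl(1), symmetric]
        frechet_derivative_at[OF fl(2), symmetric] cong: continuous_on_cong)
       (intro continuous_intros w cd dc phic)+
  have z: "flux1 B C \<phi> \<xi> = 0" "flux2 B C \<phi> \<xi> = 0" if "\<xi> \<notin> K" for \<xi>
    using zero that by (simp_all add: flux1_def flux2_def)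
  show "set_integrable lborel K (\<lambda>\<xi>. frechet_derivative (flux1 B C \<phi>) (at \<xi>) 1)"
    "set_integrable lborel K (\<lambda>\<xi>. frechet_derivative (flux2 B C \<phi>) (at \<xi>) \<i>)"
    using c K by (auto intro: set_integrable_continuous_compact continuous_on_subset)
  show "(LINT \<xi>:K|lborel. frechet_derivative (flux1 B C \<phi>) (at \<xi>) 1) = 0"
    by (rule integral_directional_derivative_zero[OF K(1) U K(2) D(1) c(1) z(1)])
  show "(LINT \<xi>:K|lborel. frechet_derivative (flux2 B C \<phi>) (at \<xi>) \<i>) = 0"
    by (rule integral_directional_derivative_zero[OF K(1) U K(2) D(2) c(2) z(2)])
qed

text \<open>Since the root of the determinant is a constant times \<open>conf(\<xi>) |1 - q| / (1 + q)\<close> and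
\<open>conf(\<xi>) (1 + q)\<^sup>2 = 4\<close>, the denominators are exactly those of the weights.\<close>

lemma variation_integrand:
  assumes B: "B \<ge> 0" "- 2 * B \<le> C" "C \<noteq> 2 * B" and e: "\<epsilon> \<in> {1, -1}"
    and xi: "\<xi> \<noteq> 0" "norm \<xi> \<noteq> 1" and diff: "\<phi> differentiable (at \<xi>)"
  defines "a \<equiv> 4 * ((lambda (Fsec \<epsilon> B C) \<xi>)\<^sup>2 - (norm (sigma (Fsec \<epsilon> B C) \<xi>))\<^sup>2) * (conf \<xi>)\<^sup>2"
    and "b \<equiv> 8 * (lambda (Fsec \<epsilon> B C) \<xi> * lambda \<phi> \<xi>
      - Re (sigma (Fsec \<epsilon> B C) \<xi> * cnj (sigma \<phi> \<xi>))) * (conf \<xi>)\<^sup>2"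
  shows "a \<noteq> 0" and "sgn a * b / (2 * sqrt \<bar>a\<bar>) =
    4 * \<epsilon> * sgn (C - 2 * B) / sqrt \<bar>C - 2 * B\<bar> *
      (frechet_derivative (flux1 B C \<phi>) (at \<xi>) 1 + frechet_derivative (flux2 B C \<phi>) (at \<xi>) \<i>)"
proof -
  define q where "q = (norm \<xi>)\<^sup>2"
  have q: "q > 0" "q \<noteq> 1"
    using norm_squared_off_circle[OF xi] by (simp_all add: q_def)
  have pos: "profile B C q > 0" by (rule profile_pos_off_circle[OF B q])
  have e2: "\<epsilon>\<^sup>2 = 1" using e by auto
  define p where "p = 1 + q"
  define r where "r = \<bar>1 - q\<bar>"
  define \<kappa> where "\<kappa> = sqrt \<bar>C - 2 * B\<bar>"
  define c where "c = conf \<xi>"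
  define d where "d = frechet_derivative (flux1 B C \<phi>) (at \<xi>) 1
    + frechet_derivative (flux2 B C \<phi>) (at \<xi>) \<i>"
  have p: "p > 0" and r: "r > 0" and k: "\<kappa> > 0" and c: "c > 0"
    using q B(3) conf_pos[of \<xi>] by (auto simp: p_def r_def \<kappa>_def c_def)
  have cp: "c = 4 / p\<^sup>2" by (simp add: c_def conf_def p_def q_def)
  have a: "a = 4 * ((C - 2 * B) * ((1 - q) / (1 + q))\<^sup>2) * (conf \<xi>)\<^sup>2"
    unfolding a_def lambda_sigma_difference[OF xi(1) q_def pos e2] ..
  define Z where "Z = 4 * ((1 - q) / (1 + q))\<^sup>2 * (conf \<xi>)\<^sup>2"
  have "Z > 0" using q c by (simp add: Z_def c_def)
  moreover have "a = (C - 2 * B) * Z" unfolding a Z_def by simp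
  ultimately have sga: "sgn a = sgn (C - 2 * B)" by (simp add: sgn_mult)
  show "a \<noteq> 0" using sga B(3) by (metis diff_eq_diff_eq diff_self sgn_0_0)
  have "\<bar>a\<bar> = (2 * \<kappa> * (r / p) * c)\<^sup>2"
    unfolding a power_mult_distrib
    using p by (simp add: abs_mult \<kappa>_def r_def p_def c_def power_divide)
  then have sqa: "sqrt \<bar>a\<bar> = 2 * \<kappa> * (r / p) * c"
    using k r p c by simp
  have sh: "profile' B C q = shear_weight B C q * (p * r)"
    and tw: "profile B C q + q * profile' B C q - 2 * q * profile B C q / (1 + q) =
      twist_weight B C q * (p * r)"
    using weights_eq[OF q pos] p r by (simp_all add: p_def r_def)
  have "lambda (Fsec \<epsilon> B C) \<xi> * lambda \<phi> \<xi> - Re (sigma (Fsec \<epsilon> B C) \<xi> * cnj (sigma \<phi> \<xi>)) =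
      \<epsilon> * (p * r) * (twist_weight B C q * lambda \<phi> \<xi>
        - shear_weight B C q * Im ((cnj \<xi>)\<^sup>2 * wirt_bar \<phi> \<xi>))"
    unfolding lambda_sigma_Fsec[OF xi(1) q_def pos] tw
    unfolding sh sigma_alt[OF diff]
    by (simp add: algebra_simps)
  also have "\<dots> = \<epsilon> * (p * r) * (d / 2)"
    unfolding d_def
    using flux_divergence[OF xi q_def pos diff[unfolded frechet_derivative_works]] by simp
  finally have b: "b = 4 * \<epsilon> * (p * r) * d * c\<^sup>2" by (simp add: b_def c_def)
  have "sgn a * b / (2 * sqrt \<bar>a\<bar>) = sgn (C - 2 * B) * \<epsilon> * d / \<kappa> * (p\<^sup>2 * c)"
    unfolding sga b sqa using p r c k by (simp add: field_simps power2_eq_square)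
  also have "p\<^sup>2 * c = 4" using p by (simp add: cp)
  finally show "sgn a * b / (2 * sqrt \<bar>a\<bar>) = 4 * \<epsilon> * sgn (C - 2 * B) / sqrt \<bar>C - 2 * B\<bar> *
      (frechet_derivative (flux1 B C \<phi>) (at \<xi>) 1 + frechet_derivative (flux2 B C \<phi>) (at \<xi>) \<i>)"
    by (simp add: d_def \<kappa>_def)
qed

lemma Fsec_area_stationary:
  assumes B: "B \<ge> 0" "- 2 * B \<le> C" "C \<noteq> 2 * B" and e: "\<epsilon> \<in> {1, -1}"
  shows "area_stationary (- {0}) (Fsec \<epsilon> B C)"
  unfolding area_stationary_def nondegenerate_locus_Fsec[OF B e]
proof (intro allI impI, elim conjE)
  fix K :: "complex set" and \<phi> :: "complex \<Rightarrow> complex"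
  let ?U = "{\<xi> :: complex. \<xi> \<noteq> 0 \<and> norm \<xi> \<noteq> 1}"
  let ?F = "Fsec \<epsilon> B C"
  assume K: "compact K" "K \<subseteq> ?U" and C1: "Ck_on 1 UNIV \<phi>" and zero: "\<forall>\<xi>. \<xi> \<notin> K \<longrightarrow> \<phi> \<xi> = 0"
  have diff: "\<phi> differentiable (at z)" for z
    using C1 by simp
  have dcont: "continuous_on UNIV (\<lambda>z. frechet_derivative \<phi> (at z) v)" for v
    using C1 by simp
  have inK: "\<xi> \<noteq> 0" "norm \<xi> \<noteq> 1" "profile B C ((norm \<xi>)\<^sup>2) > 0" if "\<xi> \<in> K" for \<xi>
  proof -
    show xi: "\<xi> \<noteq> 0" "norm \<xi> \<noteq> 1" using that K(2) by auto
    show "profile B C ((norm \<xi>)\<^sup>2) > 0"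
      by (rule profile_pos_off_circle[OF B norm_squared_off_circle[OF xi]])
  qed
  have Fdiff: "?F differentiable (at \<xi>)" if "\<xi> \<in> K" for \<xi>
    using Fsec_has_derivative[OF inK(1)[OF that] refl inK(3)[OF that]] by (rule differentiableI)
  define a where "a \<xi> = 4 * ((lambda ?F \<xi>)\<^sup>2 - (norm (sigma ?F \<xi>))\<^sup>2) * (conf \<xi>)\<^sup>2" for \<xi>
  define b where "b \<xi> = 8 * (lambda ?F \<xi> * lambda \<phi> \<xi>
      - Re (sigma ?F \<xi> * cnj (sigma \<phi> \<xi>))) * (conf \<xi>)\<^sup>2" for \<xi>
  define c where "c \<xi> = 4 * ((lambda \<phi> \<xi>)\<^sup>2 - (norm (sigma \<phi> \<xi>))\<^sup>2) * (conf \<xi>)\<^sup>2" for \<xi>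
  note w = weights_continuous[OF B, THEN continuous_on_radial, THEN continuous_on_subset, OF K(2)]
  have nz: "1 + (norm \<xi>)\<^sup>2 \<noteq> 0" for \<xi> :: complex
    using one_plus_pos(1)[of \<xi>] by simp
  have cl: "continuous_on K (lambda ?F)"
    by (subst continuous_on_cong[OF refl lambda_sigma_Fsec(1)[OF inK(1) refl inK(3)]])
       (assumption+, intro continuous_intros w, simp add: nz)
  have cs: "continuous_on K (sigma ?F)"
    by (subst continuous_on_cong[OF refl lambda_sigma_Fsec(2)[OF inK(1) refl inK(3)]])
       (assumption+, intro continuous_intros w)
  have cc: "continuous_on K conf"
    unfolding conf_def[abs_def] by (intro continuous_intros) (simp add: nz)
  note cphi = lambda_sigma_continuous_of_C1[OF diff dcont, of K]
  have cont: "continuous_on K a" "continuous_on K b" "continuous_on K c"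
    unfolding a_def[abs_def] b_def[abs_def] c_def[abs_def]
    by (intro continuous_intros cl cs cc cphi)+
  have a0: "a \<xi> \<noteq> 0" if "\<xi> \<in> K" for \<xi>
    unfolding a_def by (rule variation_integrand(1)[OF B e inK(1,2)[OF that] diff])
  have Ksets: "K \<in> sets lborel" using K(1) by (simp add: compact_imp_closed borel_closed)
  have area: "graph_area K (\<lambda>\<xi>. ?F \<xi> + t *\<^sub>R \<phi> \<xi>) =
      (LINT \<xi>:K|lborel. sqrt \<bar>a \<xi> + b \<xi> * t + c \<xi> * t\<^sup>2\<bar>)" for t
    unfolding graph_area_def
    by (rule set_lebesgue_integral_cong[OF Ksets])
       (simp add: induced_det_add[OF Fdiff diff] a_def b_def c_def)
  let ?k = "4 * \<epsilon> * sgn (C - 2 * B) / sqrt \<bar>C - 2 * B\<bar>"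
  let ?d1 = "\<lambda>\<xi>. frechet_derivative (flux1 B C \<phi>) (at \<xi>) 1"
  let ?d2 = "\<lambda>\<xi>. frechet_derivative (flux2 B C \<phi>) (at \<xi>) \<i>"
  note flux = flux_integral_zero[OF B K diff dcont zero]
  have "(LINT \<xi>:K|lborel. sgn (a \<xi>) * b \<xi> / (2 * sqrt \<bar>a \<xi>\<bar>)) =
      (LINT \<xi>:K|lborel. ?k * (?d1 \<xi> + ?d2 \<xi>))"
    by (rule set_lebesgue_integral_cong[OF Ksets])
       (auto simp only: a_def b_def intro!: variation_integrand(2)[OF B e inK(1,2) diff])
  also have "\<dots> = ?k * ((LINT \<xi>:K|lborel. ?d1 \<xi>) + (LINT \<xi>:K|lborel. ?d2 \<xi>))"
    using flux(1,2) by (simp only: set_integral_mult_right set_integral_add(2))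
  also have "\<dots> = 0" unfolding flux(3,4) by simp
  finally show "((\<lambda>t. graph_area K (\<lambda>\<xi>. ?F \<xi> + t *\<^sub>R \<phi> \<xi>)) has_real_derivative 0) (at 0)"
    using has_derivative_sqrt_quadratic_integral[OF K(1) cont a0] unfolding area by simp
qed

theorem mainTheorem5:
  fixes B2 C2 :: real
  assumes "B2 \<ge> 0" and "- 2 * B2 \<le> C2"
  shows
    "(\<forall>\<epsilon>\<in>{1, -1}. extends_through_zero (Fsec \<epsilon> B2 C2) \<and>
                   extends_through_infinity (Fsec \<epsilon> B2 C2)) \<and>
     (C2 \<noteq> 2 * B2 \<longrightarrow>
        (B2 > 0 \<longrightarrow> immersed_torus (closure (surface B2 C2))) \<and>
        (B2 > 0 \<and> - 2 * B2 < C2 \<longrightarrow> embedded_torus (closure (surface B2 C2))) \<and>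
        (\<forall>\<epsilon>\<in>{1, -1}.
           nondegenerate_locus (- {0}) (Fsec \<epsilon> B2 C2) = {\<xi>. \<xi> \<noteq> 0 \<and> norm \<xi> \<noteq> 1} \<and>
           area_stationary (- {0}) (Fsec \<epsilon> B2 C2) \<and>
           (B2 > 0 \<longrightarrow> \<not> holomorphic_graph (- {0}) (Fsec \<epsilon> B2 C2)) \<and>
           \<not> lagrangian_graph (- {0}) (Fsec \<epsilon> B2 C2)) \<and>
        (\<forall>B C. B \<ge> 0 \<and> - 2 * B \<le> C \<and> closure (surface B C) = closure (surface B2 C2) \<longrightarrow>
           B = B2 \<and> C = C2))"
proof (intro conjI impI ballI allI)
  fix \<epsilon> :: real assume e: "\<epsilon> \<in> {1, -1}"
  show "extends_through_zero (Fsec \<epsilon> B2 C2)" "extends_through_infinity (Fsec \<epsilon> B2 C2)"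
    by (rule Fsec_extends[OF assms])+
next
  assume "B2 > 0"
  then show "immersed_torus (closure (surface B2 C2))"
    using assms(2) by (rule closure_surface_immersed)
next
  assume "B2 > 0 \<and> - 2 * B2 < C2"
  then show "embedded_torus (closure (surface B2 C2))"
    by (intro closure_surface_embedded) auto
next
  fix \<epsilon> :: real assume ne: "C2 \<noteq> 2 * B2" and e: "\<epsilon> \<in> {1, -1}"
  show "nondegenerate_locus (- {0}) (Fsec \<epsilon> B2 C2) = {\<xi>. \<xi> \<noteq> 0 \<and> norm \<xi> \<noteq> 1}"
    by (rule nondegenerate_locus_Fsec[OF assms ne e])
  show "area_stationary (- {0}) (Fsec \<epsilon> B2 C2)"
    by (rule Fsec_area_stationary[OF assms ne e])
  show "\<not> lagrangian_graph (- {0}) (Fsec \<epsilon> B2 C2)"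
    by (rule Fsec_not_lagrangian[OF assms ne e])
  assume "B2 > 0"
  then show "\<not> holomorphic_graph (- {0}) (Fsec \<epsilon> B2 C2)"
    using assms(2) e by (rule Fsec_not_holomorphic)
next
  fix B C assume "B \<ge> 0 \<and> - 2 * B \<le> C \<and> closure (surface B C) = closure (surface B2 C2)"
  then show "B = B2" "C = C2"
    using closure_surface_inj[of B C B2 C2] assms by blast+
qed

end
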